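(* For every integer $a\ge 4$, the spider graph $S(a,4,1)$ is Schur positive, i.e., every coefficient of its chromatic symmetric function $X_{S(a,4,1)}$ in the Schur basis $\{s_\lambda\}$ is nonnegative.
   Context: For a simple graph $G$ with vertex set $\{v_1,v_2,\dots\}$, the chromatic symmetric function is $X_G(x_1,x_2,\dots)=\sum_{c} x_{c(v_1)}x_{c(v_2)}\cdots$, the sum over all proper colorings $c\colon V(G)\to\{1,2,3,\dots\}$. $G$ is Schur positive if all coefficients of $X_G$ in the basis of Schur functions are nonnegative. For a partition $\lambda=(\lambda_1,\lambda_2,\dots)$ of $n-1$, the spider $S(\lambda)$ is the tree on $n$ vertices obtained by taking paths $P_{\lambda_1+1},P_{\lambda_2+1},\dots$ (where $P_m$ is the path on $m$ vertices) and identifying one end vertex of each of them into a single vertex. Thus $S(a,4,1)$ has $a+6$ vertices. *)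

theory Defs
  imports Main "HOL-Library.Multiset" "HOL-Library.FuncSet"
begin

text \<open>
  A monomial in the variables \<open>x\<^sub>1, x\<^sub>2, \<dots>\<close> is represented by the multiset of its variable
  indices (so \<open>{#1, 1, 3#}\<close> is \<open>x\<^sub>1\<^sup>2 x\<^sub>3\<close>), and a formal power series with integer
  coefficients by its coefficient function. The index \<open>0\<close> never occurs.
\<close>

type_synonym power_series = "nat multiset \<Rightarrow> int"

subsection \<open>Chromatic symmetric functions\<close>

type_synonym 'a graph = "'a set \<times> 'a set set"

definition simple_graph :: "'a graph \<Rightarrow> bool" where
  "simple_graph G \<longleftrightarrow> finite (fst G) \<and> (\<forall>e\<in>snd G. e \<subseteq> fst G \<and> card e = 2)"

definition proper_colorings :: "'a graph \<Rightarrow> ('a \<Rightarrow> nat) set" where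
  "proper_colorings G =
    {c \<in> fst G \<rightarrow>\<^sub>E {0<..}. \<forall>u v. {u, v} \<in> snd G \<longrightarrow> c u \<noteq> c v}"

text \<open>Only meaningful for finite vertex sets, since \<open>mset_set\<close> of an infinite set is empty.\<close>

definition chromatic_symmetric_function :: "'a graph \<Rightarrow> power_series" where
  "chromatic_symmetric_function G m =
    int (card {c \<in> proper_colorings G. image_mset c (mset_set (fst G)) = m})"

subsection \<open>Schur functions\<close>

definition is_partition :: "nat list \<Rightarrow> bool" where
  "is_partition l \<longleftrightarrow> sorted_wrt (\<ge>) l \<and> 0 \<notin> set l"

definition cells :: "nat list \<Rightarrow> (nat \<times> nat) set" where
  "cells l = {(i, j). i < length l \<and> j < l ! i}"

text \<open>Rows and columns are numbered from \<open>0\<close>; \<open>(i, j)\<close> is the cell in row \<open>i\<close>, column \<open>j\<close>.\<close>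

definition ssyt :: "nat list \<Rightarrow> (nat \<times> nat \<Rightarrow> nat) set" where
  "ssyt l = {T \<in> cells l \<rightarrow>\<^sub>E {0<..}.
     (\<forall>i j j'. (i, j) \<in> cells l \<longrightarrow> (i, j') \<in> cells l \<longrightarrow> j < j' \<longrightarrow> T (i, j) \<le> T (i, j')) \<and>
     (\<forall>i i' j. (i, j) \<in> cells l \<longrightarrow> (i', j) \<in> cells l \<longrightarrow> i < i' \<longrightarrow> T (i, j) < T (i', j))}"

definition schur_function :: "nat list \<Rightarrow> power_series" where
  "schur_function l m = int (card {T \<in> ssyt l. image_mset T (mset_set (cells l)) = m})"

definition schur_expansion :: "power_series \<Rightarrow> (nat list \<Rightarrow> int) \<Rightarrow> bool" where
  "schur_expansion f c \<longleftrightarrow>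
     finite {l. c l \<noteq> 0} \<and> (\<forall>l. c l \<noteq> 0 \<longrightarrow> is_partition l) \<and>
     (\<forall>m. f m = (\<Sum>l | c l \<noteq> 0. c l * schur_function l m))"

text \<open>The witness \<open>c\<close> is unique, see \<open>schur_expansion_unique\<close> below.\<close>

definition schur_positive :: "power_series \<Rightarrow> bool" where
  "schur_positive f \<longleftrightarrow> (\<exists>c. schur_expansion f c \<and> (\<forall>l. c l \<ge> 0))"

subsection \<open>Spiders\<close>

text \<open>
  The \<open>i\<close>-th path has the vertices \<open>(i, 0), \<dots>, (i, l ! i)\<close>; \<open>spider_glue\<close> identifies the end
  vertices \<open>(i, 0)\<close> of all the paths. The centre is inserted explicitly for the sake of \<open>l = []\<close>.
\<close>

definition spider_glue :: "nat \<times> nat \<Rightarrow> nat \<times> nat" where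
  "spider_glue p = (if snd p = 0 then (0, 0) else p)"

definition spider :: "nat list \<Rightarrow> (nat \<times> nat) graph" where
  "spider l =
    (insert (0, 0) (spider_glue ` {(i, j). i < length l \<and> j \<le> l ! i}),
     {{spider_glue (i, j), spider_glue (i, Suc j)} | i j. i < length l \<and> j < l ! i})"

subsection \<open>Basic facts\<close>

lemma cells_Sigma: "cells l = (SIGMA i:{..<length l}. {..<l ! i})"
  by (auto simp: cells_def)

lemma finite_cells [simp]: "finite (cells l)"
  by (simp add: cells_Sigma)

lemma spider_vertices:
  "fst (spider l) = insert (0, 0) ((\<lambda>(i, j). (i, Suc j)) ` cells l)"
proof (intro equalityI subsetI)
  fix p assume "p \<in> fst (spider l)"
  then consider "p = (0, 0)" | i j where "i < length l" "j \<le> l ! i" "p = spider_glue (i, j)"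
    by (auto simp: spider_def)
  then show "p \<in> insert (0, 0) ((\<lambda>(i, j). (i, Suc j)) ` cells l)"
  proof cases
    case (2 i j)
    then show ?thesis
      by (cases j) (auto simp: spider_glue_def cells_def image_iff)
  qed auto
next
  fix p assume "p \<in> insert (0, 0) ((\<lambda>(i, j). (i, Suc j)) ` cells l)"
  then consider "p = (0, 0)" | i j where "i < length l" "j < l ! i" "p = (i, Suc j)"
    by (auto simp: cells_def)
  then show "p \<in> fst (spider l)"
  proof cases
    case (2 i j)
    then show ?thesis
      unfolding spider_def fst_conv
      by (intro insertI2 image_eqI[where x = "(i, Suc j)"]) (simp_all add: spider_glue_def)
  qed (auto simp: spider_def)
qed

lemma card_spider: "card (fst (spider l)) = Suc (sum_list l)"
proof -
  have "card ((\<lambda>(i, j). (i, Suc j)) ` cells l) = card (cells l)"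
    by (rule card_image) (auto simp: inj_on_def)
  also have "\<dots> = sum_list l"
    by (simp add: cells_Sigma sum_list_sum_nth atLeast0LessThan)
  finally show ?thesis
    by (subst spider_vertices, subst card_insert_disjoint) auto
qed

lemma simple_graph_spider: "simple_graph (spider l)"
proof -
  have "e \<subseteq> fst (spider l) \<and> card e = 2" if "e \<in> snd (spider l)" for e
  proof -
    from that obtain i j where ij: "i < length l" "j < l ! i"
      and e: "e = {spider_glue (i, j), spider_glue (i, Suc j)}"
      by (auto simp: spider_def)
    have "spider_glue (i, j) \<noteq> spider_glue (i, Suc j)"
      by (auto simp: spider_glue_def)
    then have "card e = 2" using e by simp
    moreover have "e \<subseteq> fst (spider l)"
      using ij e by (auto simp: spider_def)
    ultimately show ?thesis by simp
  qed
  then show ?thesis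
    by (auto simp: simple_graph_def spider_vertices)
qed

subsection \<open>Uniqueness of Schur expansions\<close>

lemma finite_ssyt_content: "finite {T \<in> ssyt l. image_mset T (mset_set (cells l)) = m}"
proof (rule finite_subset)
  show "{T \<in> ssyt l. image_mset T (mset_set (cells l)) = m} \<subseteq> cells l \<rightarrow>\<^sub>E set_mset m"
    by (auto simp: ssyt_def PiE_def)
  show "finite (cells l \<rightarrow>\<^sub>E set_mset m)"
    by (intro finite_PiE) auto
qed

definition top_rows :: "nat list \<Rightarrow> nat \<Rightarrow> nat" where
  "top_rows l k = card {p \<in> cells l. fst p < k}"

definition row_content :: "nat list \<Rightarrow> nat multiset" where
  "row_content l = image_mset (\<lambda>p. Suc (fst p)) (mset_set (cells l))"

lemma size_filter_image_mset_set:
  assumes "finite A"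
  shows "size (filter_mset P (image_mset f (mset_set A))) = card {x \<in> A. P (f x)}"
  using assms by (simp add: filter_mset_image_mset)

lemma schur_function_row_content: "is_partition l \<Longrightarrow> schur_function l (row_content l) \<noteq> 0"
proof -
  assume "is_partition l"
  define T where "T = restrict (\<lambda>p. Suc (fst p)) (cells l)"
  have "T \<in> ssyt l" by (auto simp: ssyt_def T_def)
  moreover have "image_mset T (mset_set (cells l)) = row_content l"
    unfolding row_content_def T_def by (intro image_mset_cong) auto
  ultimately have "{T \<in> ssyt l. image_mset T (mset_set (cells l)) = row_content l} \<noteq> {}"
    by auto
  then show ?thesis
    unfolding schur_function_def by (simp add: finite_ssyt_content)
qed

lemma ssyt_entry_ge:
  assumes "is_partition l" "T \<in> ssyt l" "(i, j) \<in> cells l"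
  shows "i < T (i, j)"
  using assms(3)
proof (induction i)
  case 0
  then show ?case using assms(2) by (auto simp: ssyt_def PiE_def Pi_def)
next
  case (Suc i)
  have "l ! i \<ge> l ! Suc i"
    using assms(1) Suc.prems by (auto simp: is_partition_def cells_def sorted_wrt_iff_nth_less)
  then have "(i, j) \<in> cells l" using Suc.prems by (auto simp: cells_def)
  moreover from this have "T (i, j) < T (Suc i, j)"
    using assms(2) Suc.prems by (auto simp: ssyt_def)
  ultimately show ?case using Suc.IH by simp
qed

lemma schur_function_dominance:
  assumes "is_partition l" "schur_function l (row_content m) \<noteq> 0"
  shows "top_rows m k \<le> top_rows l k"
proof -
  from assms(2) have "{T \<in> ssyt l. image_mset T (mset_set (cells l)) = row_content m} \<noteq> {}"
    unfolding schur_function_def by (intro notI) simp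
  then obtain T where T: "T \<in> ssyt l" "image_mset T (mset_set (cells l)) = row_content m"
    by blast
  have "top_rows m k = size (filter_mset (\<lambda>x. x \<le> k) (row_content m))"
    unfolding row_content_def top_rows_def
    by (subst size_filter_image_mset_set) (auto simp: Suc_le_eq)
  also have "\<dots> = card {p \<in> cells l. T p \<le> k}"
    unfolding T(2)[symmetric] by (subst size_filter_image_mset_set) auto
  also have "\<dots> \<le> top_rows l k"
    unfolding top_rows_def
    using ssyt_entry_ge[OF assms(1) T(1)] by (intro card_mono) fastforce+
  finally show ?thesis .
qed

lemma top_rows_Suc:
  "top_rows l (Suc k) = top_rows l k + (if k < length l then l ! k else 0)"
proof -
  have "{p \<in> cells l. fst p < Suc k} = {p \<in> cells l. fst p < k} \<union> {p \<in> cells l. fst p = k}"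
    by auto
  then have "top_rows l (Suc k) = top_rows l k + card {p \<in> cells l. fst p = k}"
    unfolding top_rows_def by (simp add: card_Un_disjoint disjoint_iff)
  moreover have "{p \<in> cells l. fst p = k} =
      (if k < length l then (\<lambda>j. (k, j)) ` {..<l ! k} else {})"
    by (auto simp: cells_def)
  moreover have "card ((\<lambda>j. (k, j)) ` {..<l ! k}) = l ! k"
    by (subst card_image) (auto simp: inj_on_def)
  ultimately show ?thesis by auto
qed

lemma top_rows_inject:
  assumes "is_partition l" "is_partition m" "length l \<le> N" "length m \<le> N"
    and "\<And>k. k \<le> N \<Longrightarrow> top_rows l k = top_rows m k"
  shows "l = m"
proof -
  have row: "(if k < length l then l ! k else 0) = (if k < length m then m ! k else 0)"
    if "k < N" for k
    using assms(5)[of k] assms(5)[of "Suc k"] that by (simp add: top_rows_Suc)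
  have pos: "l ! k > 0" if "k < length l" for k
    using assms(1) that by (metis is_partition_def gr0I nth_mem)
  have pos': "m ! k > 0" if "k < length m" for k
    using assms(2) that by (metis is_partition_def gr0I nth_mem)
  have len: "length l = length m"
  proof (rule linorder_cases)
    assume "length l < length m"
    then show ?thesis using row[of "length l"] pos'[of "length l"] assms(4) by simp
  next
    assume "length m < length l"
    then show ?thesis using row[of "length m"] pos[of "length m"] assms(3) by simp
  qed
  show ?thesis
  proof (rule nth_equalityI[OF len])
    fix k assume "k < length l"
    then show "l ! k = m ! k" using row[of k] len assms(3) by simp
  qed
qed

lemma schur_functions_independent:
  assumes "finite S" "\<And>l. l \<in> S \<Longrightarrow> is_partition l"
    and "\<And>m. (\<Sum>l\<in>S. d l * schur_function l m) = 0"
  shows "\<forall>l\<in>S. d l = 0"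
proof (rule ccontr)
  assume "\<not> (\<forall>l\<in>S. d l = 0)"
  define R where "R = {l \<in> S. d l \<noteq> 0}"
  have R: "finite R" "R \<noteq> {}"
    using assms(1) \<open>\<not> _\<close> by (auto simp: R_def)
  define N where "N = Max (length ` R)"
  define \<Phi> where "\<Phi> l = (\<Sum>k\<le>N. top_rows l k)" for l
  have len: "length l \<le> N" if "l \<in> R" for l
    unfolding N_def using R that by (intro Max_ge) auto
  have "Max (\<Phi> ` R) \<in> \<Phi> ` R" using R by (intro Max_in) auto
  then obtain r where r: "r \<in> R" "\<Phi> r = Max (\<Phi> ` R)" by (metis imageE)
  have max: "\<Phi> l \<le> \<Phi> r" if "l \<in> R" for l
    unfolding r(2) using R that by (intro Max_ge) auto
  have vanish: "d l * schur_function l (row_content r) = 0" if l: "l \<in> S - {r}" for l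
  proof (rule ccontr)
    assume nz: "d l * schur_function l (row_content r) \<noteq> 0"
    then have lR: "l \<in> R" using l by (auto simp: R_def)
    have dom: "top_rows r k \<le> top_rows l k" for k
      using nz l assms(2) by (intro schur_function_dominance) auto
    have "top_rows l k = top_rows r k" if "k \<le> N" for k
    proof (rule ccontr)
      assume "top_rows l k \<noteq> top_rows r k"
      then have "top_rows r k < top_rows l k" using dom[of k] by simp
      then have "\<Phi> r < \<Phi> l"
        unfolding \<Phi>_def using dom that by (intro sum_strict_mono_ex1) auto
      then show False using max[OF lR] by simp
    qed
    then have "l = r"
      using len[OF lR] len[OF r(1)] lR r(1) assms(2)
      by (intro top_rows_inject[of l r N]) (auto simp: R_def)
    then show False using l by simp
  qed
  have "(\<Sum>l\<in>S. d l * schur_function l (row_content r)) = d r * schur_function r (row_content r)"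
  proof -
    have "(\<Sum>l\<in>S - {r}. d l * schur_function l (row_content r)) = 0"
      using vanish by (intro sum.neutral) blast
    then show ?thesis
      using assms(1) r(1) sum.remove[of S r "\<lambda>l. d l * schur_function l (row_content r)"]
      by (simp add: R_def)
  qed
  then have "d r * schur_function r (row_content r) = 0"
    using assms(3) by simp
  then show False
    using r(1) assms(2) schur_function_row_content[of r] by (auto simp: R_def)
qed

lemma schur_expansion_unique:
  assumes "schur_expansion f c" "schur_expansion f c'"
  shows "c = c'"
proof -
  define S where "S = {l. c l \<noteq> 0} \<union> {l. c' l \<noteq> 0}"
  have S: "finite S" "\<And>l. l \<in> S \<Longrightarrow> is_partition l"
    using assms by (auto simp: S_def schur_expansion_def)
  have fc: "f m = (\<Sum>l\<in>S. c l * schur_function l m)" for m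
  proof -
    have "f m = (\<Sum>l | c l \<noteq> 0. c l * schur_function l m)"
      using assms(1) by (simp add: schur_expansion_def)
    also have "\<dots> = (\<Sum>l\<in>S. c l * schur_function l m)"
      using S(1) by (intro sum.mono_neutral_left) (auto simp: S_def)
    finally show ?thesis .
  qed
  have fc': "f m = (\<Sum>l\<in>S. c' l * schur_function l m)" for m
  proof -
    have "f m = (\<Sum>l | c' l \<noteq> 0. c' l * schur_function l m)"
      using assms(2) by (simp add: schur_expansion_def)
    also have "\<dots> = (\<Sum>l\<in>S. c' l * schur_function l m)"
      using S(1) by (intro sum.mono_neutral_left) (auto simp: S_def)
    finally show ?thesis .
  qed
  have diff: "(\<Sum>l\<in>S. (c l - c' l) * schur_function l m) = 0" for m
    using fc[of m] fc'[of m] by (simp add: left_diff_distrib sum_subtractf)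
  have "\<forall>l\<in>S. c l - c' l = 0"
    by (rule schur_functions_independent[OF S(1)]) (fact S(2), fact diff)
  then have "c l = c' l" if "l \<in> S" for l
    using that by simp
  moreover have "c l = c' l" if "l \<notin> S" for l
    using that unfolding S_def by simp
  ultimately show ?thesis by blast
qed

end

theory Submission
  imports Defs "HOL-Library.Poly_Mapping"
begin

text \<open>
  Write \<open>P n\<close> for the chromatic symmetric function of the path on \<open>n\<close> vertices and \<open>e k\<close> for the
  elementary symmetric functions. Cutting the spider \<open>S(a, 4, 1)\<close>, \<open>n = a + 6\<close>, at its centre gives
  \<open>X n = P n + e 1 * P (n - 1) - P 5 * P (n - 5)\<close>. Since
  \<open>P n = e n + (\<Sum>k\<le>n. (k - 1) * e k * P (n - k))\<close>, the functions \<open>X n\<close> satisfy the same recurrence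
  with \<open>e n\<close> replaced by \<open>e n + e 1 * e (n - 1) - P 5 * e (n - 5)\<close>. The only negative term is absorbed
  by the summand \<open>(n - 6) * e (n - 5) * X 5\<close>, because \<open>2 * X 5 - P 5\<close> equals
  \<open>5 * (e 1 * e 4 - e 5) + 3 * e 2 * (e 1 * e 2 - e 3) + 4 * e 3 * (e 1 * e 1 - e 2)\<close>, and
  \<open>e 1 * e k - e (k + 1)\<close> is the Schur function of a hook. So for \<open>n \<ge> 8\<close> Schur positivity follows by
  induction from the dual Pieri rule, and \<open>X 7\<close> is treated by hand.

  Everything is done with polynomials in \<open>N\<close> variables. The dual Pieri rule is proved by induction on
  \<open>N\<close>, removing the largest entries of the tableaux.
\<close>

subsection \<open>Elementary symmetric polynomials\<close>

text \<open>The values \<open>x i\<close> lie in an arbitrary commutative ring, so all identities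
  are proved for any substitution; they become genuine variables only through
  \<open>variable\<close>.\<close>

definition elementary :: "(nat \<Rightarrow> 'a::comm_ring_1) \<Rightarrow> nat \<Rightarrow> nat \<Rightarrow> 'a" where
  "elementary x N k = (\<Sum>S | S \<subseteq> {1..N} \<and> card S = k. \<Prod>i\<in>S. x i)"

lemma elementary_0 [simp]: "elementary x N 0 = 1"
proof -
  have "{S. S \<subseteq> {1..N} \<and> card S = 0} = {{}}"
    by (auto dest: finite_subset)
  then show ?thesis by (simp add: elementary_def)
qed

lemma elementary_no_variables: "elementary x 0 k = (if k = 0 then 1 else 0)"
proof -
  have "{S. S \<subseteq> {1..0::nat} \<and> card S = k} = (if k = 0 then {{}} else {})"
    by auto
  then show ?thesis by (simp add: elementary_def)
qed

lemma elementary_Suc_variables: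
  "elementary x (Suc N) (Suc k) = elementary x N (Suc k) + x (Suc N) * elementary x N k"
proof -
  let ?A = "{S. S \<subseteq> {1..N} \<and> card S = Suc k}"
  let ?B = "{S. S \<subseteq> {1..N} \<and> card S = k}"
  have fin: "finite S" if "S \<subseteq> {1..N}" for S
    using that finite_subset by blast
  have notin: "Suc N \<notin> S" if "S \<subseteq> {1..N}" for S
    using that by auto
  have split: "{S. S \<subseteq> {1..Suc N} \<and> card S = Suc k} = ?A \<union> insert (Suc N) ` ?B"
  proof (intro equalityI subsetI)
    fix S assume S: "S \<in> {S. S \<subseteq> {1..Suc N} \<and> card S = Suc k}"
    show "S \<in> ?A \<union> insert (Suc N) ` ?B"
    proof (cases "Suc N \<in> S")
      case True
      have "S - {Suc N} \<in> ?B"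
        using S True finite_subset[of S "{1..Suc N}"] by (auto simp: card_Diff_singleton le_Suc_eq)
      then show ?thesis
        using True by (intro UnI2 image_eqI[of _ _ "S - {Suc N}"]) auto
    next
      case False
      then have "S \<subseteq> {1..N}" using S by (force simp: le_Suc_eq)
      then show ?thesis using S by auto
    qed
  next
    fix S assume "S \<in> ?A \<union> insert (Suc N) ` ?B"
    then show "S \<in> {S. S \<subseteq> {1..Suc N} \<and> card S = Suc k}"
    proof
      assume "S \<in> insert (Suc N) ` ?B"
      then obtain R where R: "R \<subseteq> {1..N}" "card R = k" "S = insert (Suc N) R" by auto
      then show ?thesis using notin[of R] fin[of R] by auto
    qed auto
  qed
  have inj: "inj_on (insert (Suc N)) ?B"
    by (rule inj_onI) (metis (mono_tags, lifting) insert_ident mem_Collect_eq notin)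
  have "elementary x (Suc N) (Suc k) =
      (\<Sum>S\<in>?A. prod x S) + (\<Sum>S\<in>insert (Suc N) ` ?B. prod x S)"
    unfolding elementary_def split
    by (rule sum.union_disjoint) (auto simp: notin)
  also have "(\<Sum>S\<in>insert (Suc N) ` ?B. prod x S) = (\<Sum>S\<in>?B. x (Suc N) * prod x S)"
    unfolding sum.reindex[OF inj] using fin notin by (intro sum.cong) auto
  finally show ?thesis by (simp add: elementary_def sum_distrib_left)
qed

subsection \<open>Shapes and tableaux\<close>

text \<open>Partitions are encoded as sequences that are eventually 0, so that adding cells or
  comparing consecutive rows involves no list lengths.\<close>

definition shape :: "(nat \<Rightarrow> nat) \<Rightarrow> bool" where
  "shape l \<longleftrightarrow> antimono l \<and> (\<exists>n. l n = 0)"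

definition diagram :: "(nat \<Rightarrow> nat) \<Rightarrow> (nat \<times> nat) set" where
  "diagram l = {(i, j). j < l i}"

definition tableaux :: "nat \<Rightarrow> (nat \<Rightarrow> nat) \<Rightarrow> (nat \<times> nat \<Rightarrow> nat) set" where
  "tableaux N l = {T \<in> diagram l \<rightarrow>\<^sub>E {1..N}.
     (\<forall>i j j'. (i, j) \<in> diagram l \<longrightarrow> (i, j') \<in> diagram l \<longrightarrow> j < j' \<longrightarrow> T (i, j) \<le> T (i, j')) \<and>
     (\<forall>i i' j. (i, j) \<in> diagram l \<longrightarrow> (i', j) \<in> diagram l \<longrightarrow> i < i' \<longrightarrow> T (i, j) < T (i', j))}"

definition schur_poly :: "(nat \<Rightarrow> 'a::comm_ring_1) \<Rightarrow> nat \<Rightarrow> (nat \<Rightarrow> nat) \<Rightarrow> 'a" where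
  "schur_poly x N l = (\<Sum>T\<in>tableaux N l. \<Prod>p\<in>diagram l. x (T p))"

text \<open>The shapes \<open>\<mu>\<close> such that \<open>l / \<mu>\<close> is a horizontal strip.\<close>

definition interlacing :: "(nat \<Rightarrow> nat) \<Rightarrow> (nat \<Rightarrow> nat) set" where
  "interlacing l = {\<mu>. \<forall>i. l (Suc i) \<le> \<mu> i \<and> \<mu> i \<le> l i}"

text \<open>A vertical strip has at most one cell per row, so the set \<open>S\<close> of its rows
  determines it. The result is a shape only for suitable \<open>S\<close>.\<close>

definition add_cells :: "(nat \<Rightarrow> nat) \<Rightarrow> nat set \<Rightarrow> nat \<Rightarrow> nat" where
  "add_cells l S i = (if i \<in> S then Suc (l i) else l i)"

definition vertical_strips :: "nat \<Rightarrow> (nat \<Rightarrow> nat) \<Rightarrow> (nat \<Rightarrow> nat) set" where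
  "vertical_strips k l = {\<mu>. shape \<mu> \<and> (\<exists>S. finite S \<and> card S = k \<and> \<mu> = add_cells l S)}"

lemma shape_le: "shape l \<Longrightarrow> i \<le> j \<Longrightarrow> l j \<le> l i"
  by (auto simp: shape_def antimono_def)

lemma shapeI: "(\<And>i. l (Suc i) \<le> l i) \<Longrightarrow> l n = 0 \<Longrightarrow> shape l"
  unfolding shape_def antimono_iff_le_Suc by auto

lemma shape_eventually_0: "shape l \<Longrightarrow> \<exists>n. \<forall>i\<ge>n. l i = 0"
  unfolding shape_def antimono_def by (metis le_zero_eq)

lemma finite_diagram: assumes "shape l" shows "finite (diagram l)"
proof -
  obtain n where n: "\<And>i. i \<ge> n \<Longrightarrow> l i = 0"
      using shape_eventually_0[OF assms] by blast
  have "diagram l \<subseteq> {..<n} \<times> {..<l 0}"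
  proof
    fix p assume "p \<in> diagram l"
    then obtain i j where p: "p = (i, j)" "j < l i" by (auto simp: diagram_def)
    have "i < n" using n[of i] p by (metis not_le not_less_zero)
    moreover have "j < l 0" using p shape_le[OF assms, of 0 i] by simp
    ultimately show "p \<in> {..<n} \<times> {..<l 0}" using p by simp
  qed
  then show ?thesis by (rule finite_subset) simp
qed

lemma finite_tableaux: "shape l \<Longrightarrow> finite (tableaux N l)"
  unfolding tableaux_def by (rule finite_subset[of _ "diagram l \<rightarrow>\<^sub>E {1..N}"])
    (auto intro: finite_PiE finite_diagram)

lemma shape_interlacing: "shape l \<Longrightarrow> \<mu> \<in> interlacing l \<Longrightarrow> shape \<mu>"
proof -
  assume l: "shape l" and \<mu>: "\<mu> \<in> interlacing l"
  have "l (Suc i) \<le> \<mu> i" "\<mu> i \<le> l i" for i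
    using \<mu> by (auto simp: interlacing_def)
  moreover obtain n where "l n = 0" using l by (auto simp: shape_def)
  ultimately show "shape \<mu>"
    by (metis le_trans le_zero_eq shapeI)
qed

lemma finite_functions_bounded:
  "finite {f :: nat \<Rightarrow> nat. \<forall>i. f i \<le> b \<and> (i \<ge> n \<longrightarrow> f i = 0)}"
  by (rule finite_subset[OF _ finite_set_of_finite_funs[of "{..<n}" "{..b}" 0]]) auto

lemma finite_interlacing: assumes "shape l" shows "finite (interlacing l)"
proof -
  obtain n where n: "\<And>i. i \<ge> n \<Longrightarrow> l i = 0"
      using shape_eventually_0[OF assms] by blast
  have "f i \<le> l 0 \<and> (i \<ge> n \<longrightarrow> f i = 0)" if "f \<in> interlacing l" for f i
    using that shape_le[OF assms, of 0 i] n[of i] unfolding interlacing_def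
    by (auto intro: le_trans dest: spec[of _ i])
  then show ?thesis
    by (intro finite_subset[OF _ finite_functions_bounded[of "l 0" n]]) auto
qed

lemma diagram_interlacing: "\<mu> \<in> interlacing l \<Longrightarrow> diagram \<mu> \<subseteq> diagram l"
  by (force simp: diagram_def interlacing_def intro: less_le_trans)

lemma card_diagram_interlacing:
  "shape l \<Longrightarrow> \<mu> \<in> interlacing l \<Longrightarrow> card (diagram \<mu>) \<le> card (diagram l)"
  by (intro card_mono finite_diagram diagram_interlacing)

lemma card_diagram_add_cells:
  assumes "shape l" "finite S"
  shows "card (diagram (add_cells l S)) = card (diagram l) + card S"
proof -
  have "diagram (add_cells l S) = diagram l \<union> (\<lambda>i. (i, l i)) ` S"
    by (auto simp: diagram_def add_cells_def less_Suc_eq split: if_splits)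
  moreover have "diagram l \<inter> (\<lambda>i. (i, l i)) ` S = {}"
    by (auto simp: diagram_def)
  moreover have "card ((\<lambda>i. (i, l i)) ` S) = card S"
    by (rule card_image) (auto simp: inj_on_def)
  ultimately show ?thesis
    using assms by (simp add: card_Un_disjoint finite_diagram)
qed

lemma shape_vertical_strips: "\<mu> \<in> vertical_strips k l \<Longrightarrow> shape \<mu>"
  by (simp add: vertical_strips_def)

lemma card_diagram_vertical_strips:
  "shape l \<Longrightarrow> \<mu> \<in> vertical_strips k l \<Longrightarrow> card (diagram \<mu>) = card (diagram l) + k"
  by (auto simp: vertical_strips_def card_diagram_add_cells)

lemma finite_vertical_strips: assumes "shape l" shows "finite (vertical_strips k l)"
proof -
  obtain n where n: "\<And>i. i \<ge> n \<Longrightarrow> l i = 0"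
      using shape_eventually_0[OF assms] by blast
  have "\<mu> i \<le> Suc (l 0) \<and> (i \<ge> n + k \<longrightarrow> \<mu> i = 0)" if mu: "\<mu> \<in> vertical_strips k l" for \<mu> i
  proof -
    obtain S where S: "shape \<mu>" "finite S" "card S = k" "\<mu> = add_cells l S"
      using mu by (auto simp: vertical_strips_def)
    \<comment> \<open>If row \<open>i\<close> of \<mu> were nonempty, then so would be all rows from
      \<open>n\<close> to \<open>i\<close>. These are empty in \<open>l\<close>, so they all belong
      to \<open>S\<close>, which has only \<open>k\<close> elements.\<close>
    have "\<mu> i = 0" if "i \<ge> n + k"
    proof (rule ccontr)
      assume "\<mu> i \<noteq> 0"
      then have "\<mu> j > 0" if "j \<le> i" for j
        using shape_le[OF S(1) that] by simp
      then have "{n..i} \<subseteq> S"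
        using n S(4) by (force simp: add_cells_def split: if_splits)
      then have "card {n..i} \<le> k" using S card_mono by blast
      then show False using that by simp
    qed
    moreover have "\<mu> i \<le> Suc (l 0)"
      using shape_le[OF assms, of 0 i] by (simp add: S(4) add_cells_def)
    ultimately show ?thesis by simp
  qed
  then show ?thesis
    by (intro finite_subset[OF _ finite_functions_bounded[of "Suc (l 0)" "n + k"]]) auto
qed

lemma add_cells_empty [simp]: "add_cells l {} = l"
  by (simp add: add_cells_def fun_eq_iff)

lemma vertical_strips_0: "shape l \<Longrightarrow> vertical_strips 0 l = {l}"
proof -
  assume "shape l"
  then have "shape \<mu> \<and> (\<exists>S. finite S \<and> card S = 0 \<and> \<mu> = add_cells l S) \<longleftrightarrow> \<mu> = l" for \<mu>
    by (metis add_cells_empty card_0_eq finite.emptyI)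
  then show ?thesis by (simp add: vertical_strips_def)
qed

lemma initial_segment_nat:
  fixes S :: "nat set"
  assumes fin: "finite S" and closed: "\<And>i j. j \<in> S \<Longrightarrow> i \<le> j \<Longrightarrow> i \<in> S"
  shows "S = {..<card S}"
proof (cases "S = {}")
  case False
  then have "Max S \<in> S" using fin Max_in by blast
  then have "S = {..Max S}"
    using closed[of "Max S"] Max_ge[OF fin] by blast
  then show ?thesis by (metis card_atMost lessThan_Suc_atMost)
qed simp

lemma schur_poly_empty: "schur_poly x N (\<lambda>_. 0) = 1"
proof -
  have "diagram (\<lambda>_. 0) = {}" by (simp add: diagram_def)
  then have "tableaux N (\<lambda>_. 0) = {\<lambda>_. undefined}" by (auto simp: tableaux_def)
  then show ?thesis using \<open>diagram _ = {}\<close> by (simp add: schur_poly_def)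
qed

lemma schur_poly_no_variables:
  "schur_poly x 0 l = (if l = (\<lambda>_. 0) then 1 else 0)"
proof (cases "l = (\<lambda>_. 0)")
  case True
  then show ?thesis by (simp add: schur_poly_empty)
next
  case False
  then obtain i where "l i > 0" by (auto simp: fun_eq_iff)
  then have "(i, 0) \<in> diagram l" by (simp add: diagram_def)
  then have "tableaux 0 l = {}" by (auto simp: tableaux_def PiE_iff)
  then show ?thesis using False by (simp add: schur_poly_def)
qed

section \<open>Branching rule: splitting off the largest entry of a tableau\<close>

lemma tableaux_entry: "T \<in> tableaux N l \<Longrightarrow> p \<in> diagram l \<Longrightarrow> T p \<in> {1..N}"
  by (auto simp: tableaux_def)

lemma tableaux_extensional: "T \<in> tableaux N l \<Longrightarrow> p \<notin> diagram l \<Longrightarrow> T p = undefined"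
  by (auto simp: tableaux_def)

lemma tableaux_row:
  "T \<in> tableaux N l \<Longrightarrow> (i, j') \<in> diagram l \<Longrightarrow> j \<le> j' \<Longrightarrow> T (i, j) \<le> T (i, j')"
  by (cases "j = j'") (auto simp: tableaux_def diagram_def)

lemma tableaux_column:
  "shape l \<Longrightarrow> T \<in> tableaux N l \<Longrightarrow> (i', j) \<in> diagram l \<Longrightarrow> i < i' \<Longrightarrow> T (i, j) < T (i', j)"
  using shape_le[of l i i'] by (auto simp: tableaux_def diagram_def)

text \<open>The shape of the part of \<open>T\<close> with entries at most \<open>N\<close>.
  Counting is enough because rows increase weakly, so these entries form an initial segment of each
  row.\<close>

definition restricted_shape :: "nat \<Rightarrow> (nat \<Rightarrow> nat) \<Rightarrow> (nat \<times> nat \<Rightarrow> nat) \<Rightarrow> nat \<Rightarrow> nat" where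
  "restricted_shape N l T i = card {j. j < l i \<and> T (i, j) \<le> N}"

lemma diagram_restricted_shape:
  assumes "T \<in> tableaux M l"
  shows "diagram (restricted_shape N l T) = {p \<in> diagram l. T p \<le> N}"
proof -
  have "{j. j < l i \<and> T (i, j) \<le> N} = {..<restricted_shape N l T i}" for i
  proof -
    let ?J = "{j. j < l i \<and> T (i, j) \<le> N}"
    have closed: "j \<in> ?J" if "j' \<in> ?J" "j \<le> j'" for j j'
      using tableaux_row[OF assms, of i j' j] that by (auto simp: diagram_def)
    have "?J = {..<card ?J}"
      by (rule initial_segment_nat[OF _ closed]) auto
    then show ?thesis by (simp add: restricted_shape_def)
  qed
  then show ?thesis by (fastforce simp: diagram_def)
qed

lemma diagram_inject: "diagram l = diagram \<mu> \<Longrightarrow> l = \<mu>"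
proof
  fix i assume "diagram l = diagram \<mu>"
  then have "j < l i \<longleftrightarrow> j < \<mu> i" for j by (auto simp: diagram_def set_eq_iff)
  then show "l i = \<mu> i" by (meson less_irrefl linorder_neqE_nat)
qed

text \<open>Columns increase strictly, so an entry with another cell below it is smaller than
  \<open>Suc N\<close>. Hence row \<open>i\<close> keeps at least its first \<open>l (Suc i)\<close>
  cells.\<close>

lemma restricted_shape_interlacing:
  assumes l: "shape l" and T: "T \<in> tableaux (Suc N) l"
  shows "restricted_shape N l T \<in> interlacing l"
proof -
  have "l (Suc i) \<le> restricted_shape N l T i \<and> restricted_shape N l T i \<le> l i" for i
  proof
    have "{..<l (Suc i)} \<subseteq> {j. j < l i \<and> T (i, j) \<le> N}"
      using tableaux_column[OF l T, of "Suc i" _ i] tableaux_entry[OF T, of "(Suc i, _)"]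
        shape_le[OF l, of i "Suc i"]
      by (fastforce simp: diagram_def)
    from card_mono[OF _ this] show "l (Suc i) \<le> restricted_shape N l T i"
      by (simp add: restricted_shape_def)
    have "restricted_shape N l T i \<le> card {..<l i}"
      unfolding restricted_shape_def by (intro card_mono) auto
    then show "restricted_shape N l T i \<le> l i" by simp
  qed
  then show ?thesis by (simp add: interlacing_def)
qed

text \<open>Fills the strip between \<mu> and \<open>l\<close> with the new largest entry. The value
  \<open>undefined\<close> elsewhere makes the function extensional, as \<open>tableaux\<close>
  demands.\<close>

definition extend_tableau ::
  "nat \<Rightarrow> (nat \<Rightarrow> nat) \<Rightarrow> (nat \<Rightarrow> nat) \<Rightarrow> (nat \<times> nat \<Rightarrow> nat) \<Rightarrow> nat \<times> nat \<Rightarrow> nat" where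
  "extend_tableau N l \<mu> T p =
    (if p \<in> diagram \<mu> then T p else if p \<in> diagram l then Suc N else undefined)"

lemma extend_tableau_tableaux:
  assumes l: "shape l" and \<mu>: "\<mu> \<in> interlacing l" and T: "T \<in> tableaux N \<mu>"
  shows "extend_tableau N l \<mu> T \<in> tableaux (Suc N) l"
proof -
  note \<mu>s = shape_interlacing[OF l \<mu>]
  have sub: "diagram \<mu> \<subseteq> diagram l" using diagram_interlacing[OF \<mu>] .
  have row: "(i, j) \<in> diagram \<mu>" if "(i, j') \<in> diagram \<mu>" "j < j'" for i j j'
    using that by (auto simp: diagram_def)
  \<comment> \<open>Only the lowest cell of a column of \<open>l\<close> can lie outside \<mu>, so
    \<open>Suc N\<close> never occurs twice in a column.\<close>
  have col: "(i, j) \<in> diagram \<mu>" if "(i', j) \<in> diagram l" "i < i'" for i i' j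
  proof -
    have "l i' \<le> l (Suc i)" using shape_le[OF l, of "Suc i" i'] that by simp
    also have "\<dots> \<le> \<mu> i" using \<mu> by (simp add: interlacing_def)
    finally show ?thesis using that by (auto simp: diagram_def)
  qed
  have entry: "T p \<le> N" "0 < T p" if "p \<in> diagram \<mu>" for p
    using tableaux_entry[OF T that] by auto
  let ?E = "extend_tableau N l \<mu> T"
  have "?E \<in> diagram l \<rightarrow>\<^sub>E {1..Suc N}"
    using sub entry by (fastforce simp: extend_tableau_def Suc_le_eq intro: le_SucI)
  moreover have "?E (i, j) \<le> ?E (i, j')"
    if "(i, j) \<in> diagram l" "(i, j') \<in> diagram l" "j < j'" for i j j'
    using that row[of i j' j] tableaux_row[OF T, of i j' j] entry(1)[of "(i, j)"]
    by (auto simp: extend_tableau_def)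
  moreover have "?E (i, j) < ?E (i', j)"
    if "(i, j) \<in> diagram l" "(i', j) \<in> diagram l" "i < i'" for i i' j
    using that col[of i' j i] tableaux_column[OF \<mu>s T, of i' j i] entry(1)[of "(i, j)"]
    by (auto simp: extend_tableau_def)
  ultimately show ?thesis by (simp add: tableaux_def)
qed

lemma restrict_tableau_tableaux:
  assumes l: "shape l" and T: "T \<in> tableaux (Suc N) l"
  shows "restrict T (diagram (restricted_shape N l T)) \<in> tableaux N (restricted_shape N l T)"
proof -
  let ?D = "diagram (restricted_shape N l T)"
  have D: "p \<in> diagram l" "T p \<le> N" if "p \<in> ?D" for p
    using that by (auto simp: diagram_restricted_shape[OF T])
  have "restrict T ?D \<in> ?D \<rightarrow>\<^sub>E {1..N}"
    using D tableaux_entry[OF T] by (fastforce simp: PiE_iff)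
  then show ?thesis
    using D tableaux_row[OF T] tableaux_column[OF l T] by (auto simp: tableaux_def)
qed

text \<open>The cells with entry \<open>Suc N\<close> form a horizontal strip. Deleting them is a
  bijection from tableaux of shape \<open>l\<close> onto pairs of an interlacing shape \<mu> and a
  tableau of shape \<mu>; each deleted cell contributes a factor \<open>x (Suc N)\<close>.\<close>

lemma schur_poly_Suc_variables:
  assumes l: "shape l"
  shows "schur_poly x (Suc N) l =
    (\<Sum>\<mu>\<in>interlacing l. x (Suc N) ^ (card (diagram l) - card (diagram \<mu>)) * schur_poly x N \<mu>)"
proof -
  let ?w = "\<lambda>(\<mu>, T). x (Suc N) ^ (card (diagram l) - card (diagram \<mu>)) * (\<Prod>p\<in>diagram \<mu>. x (T p))"
  have "schur_poly x (Suc N) l = sum ?w (SIGMA \<mu>:interlacing l. tableaux N \<mu>)"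
    unfolding schur_poly_def
  proof (rule sum.reindex_bij_witness[where
        j = "\<lambda>T. (restricted_shape N l T, restrict T (diagram (restricted_shape N l T)))" and
        i = "\<lambda>(\<mu>, T). extend_tableau N l \<mu> T"])
    fix T assume T: "T \<in> tableaux (Suc N) l"
    let ?\<mu> = "restricted_shape N l T"
    note D = diagram_restricted_shape[OF T]
    have inter: "?\<mu> \<in> interlacing l" using restricted_shape_interlacing[OF l T] .
    show "(case (?\<mu>, restrict T (diagram ?\<mu>)) of (\<mu>, T) \<Rightarrow> extend_tableau N l \<mu> T) = T"
    proof
      fix p
      have "T p = Suc N" if "p \<in> diagram l" "\<not> T p \<le> N"
        using tableaux_entry[OF T that(1)] that(2) by auto
      then show "(case (?\<mu>, restrict T (diagram ?\<mu>)) of (\<mu>, T) \<Rightarrow> extend_tableau N l \<mu> T) p = T p"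
        using tableaux_extensional[OF T, of p] by (auto simp: extend_tableau_def D)
    qed
    show "(?\<mu>, restrict T (diagram ?\<mu>)) \<in> (SIGMA \<mu>:interlacing l. tableaux N \<mu>)"
      using inter restrict_tableau_tableaux[OF l T] by simp
    have sub: "diagram ?\<mu> \<subseteq> diagram l" using diagram_interlacing[OF inter] .
    have "(\<Prod>p\<in>diagram l. x (T p)) =
        (\<Prod>p\<in>diagram l - diagram ?\<mu>. x (T p)) * (\<Prod>p\<in>diagram ?\<mu>. x (T p))"
      by (rule prod.subset_diff[OF sub finite_diagram[OF l]])
    also have "(\<Prod>p\<in>diagram l - diagram ?\<mu>. x (T p)) = (\<Prod>p\<in>diagram l - diagram ?\<mu>. x (Suc N))"
      using tableaux_entry[OF T] by (intro prod.cong) (force simp: D le_Suc_eq)+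
    also have "\<dots> = x (Suc N) ^ (card (diagram l) - card (diagram ?\<mu>))"
      using finite_subset[OF sub finite_diagram[OF l]] sub by (simp add: card_Diff_subset)
    finally show "?w (?\<mu>, restrict T (diagram ?\<mu>)) = (\<Prod>p\<in>diagram l. x (T p))"
      by simp
  next
    fix q assume "q \<in> (SIGMA \<mu>:interlacing l. tableaux N \<mu>)"
    then obtain \<mu> T where q: "q = (\<mu>, T)" "\<mu> \<in> interlacing l" "T \<in> tableaux N \<mu>" by auto
    have E: "extend_tableau N l \<mu> T \<in> tableaux (Suc N) l"
      by (rule extend_tableau_tableaux[OF l q(2,3)])
    then show "(case q of (\<mu>, T) \<Rightarrow> extend_tableau N l \<mu> T) \<in> tableaux (Suc N) l"
      by (simp add: q(1))
    have "diagram (restricted_shape N l (extend_tableau N l \<mu> T)) = diagram \<mu>"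
      unfolding diagram_restricted_shape[OF E]
      using diagram_interlacing[OF q(2)] tableaux_entry[OF q(3)]
      by (auto simp: extend_tableau_def split: if_splits)
    then have eq: "restricted_shape N l (extend_tableau N l \<mu> T) = \<mu>"
      by (rule diagram_inject)
    have "restrict (extend_tableau N l \<mu> T) (diagram \<mu>) = T"
      using tableaux_extensional[OF q(3)] by (auto simp: extend_tableau_def fun_eq_iff restrict_def)
    then show "(restricted_shape N l (case q of (\<mu>, T) \<Rightarrow> extend_tableau N l \<mu> T),
        restrict (case q of (\<mu>, T) \<Rightarrow> extend_tableau N l \<mu> T)
         (diagram (restricted_shape N l (case q of (\<mu>, T) \<Rightarrow> extend_tableau N l \<mu> T)))) = q"
      by (simp add: q(1) eq)
  qed
  also have "\<dots> = (\<Sum>\<mu>\<in>interlacing l.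
      x (Suc N) ^ (card (diagram l) - card (diagram \<mu>)) * schur_poly x N \<mu>)"
    using finite_interlacing[OF l] finite_tableaux shape_interlacing[OF l]
    by (subst sum.Sigma[symmetric]) (auto simp: schur_poly_def sum_distrib_left)
  finally show ?thesis .
qed

subsection \<open>The dual Pieri rule\<close>

text \<open>Removing the forced elements \<open>A\<close> leaves an arbitrary subset of
  \<open>U - A\<close>. The case distinction guards against truncated subtraction in
  \<open>k - card A\<close>.\<close>

lemma card_subsets_between:
  assumes "finite U" "A \<subseteq> U"
  shows "card {S. A \<subseteq> S \<and> S \<subseteq> U \<and> card S = k} =
    (if card A \<le> k then (card U - card A) choose (k - card A) else 0)"
proof (cases "card A \<le> k")
  case True
  have fA: "finite A" using assms finite_subset by blast
  have "bij_betw (\<lambda>S. S - A) {S. A \<subseteq> S \<and> S \<subseteq> U \<and> card S = k}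
      {S. S \<subseteq> U - A \<and> card S = k - card A}"
  proof (rule bij_betw_byWitness[where f' = "\<lambda>S. S \<union> A"])
    show "(\<lambda>S. S \<union> A) ` {S. S \<subseteq> U - A \<and> card S = k - card A}
        \<subseteq> {S. A \<subseteq> S \<and> S \<subseteq> U \<and> card S = k}"
    proof safe
      fix S assume S: "S \<subseteq> U - A" "card S = k - card A"
      have "finite S" using S assms by (meson finite_Diff finite_subset)
      then show "card (S \<union> A) = k"
        using S True fA by (subst card_Un_disjoint) auto
    qed (use assms in auto)
  qed (use fA in \<open>auto simp: card_Diff_subset\<close>)
  then show ?thesis
    using True assms n_subsets[of "U - A" "k - card A"]
    by (simp add: bij_betw_same_card card_Diff_subset fA)
next
  case False
  have "card A \<le> card S" if "A \<subseteq> S" "S \<subseteq> U" for S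
    using that assms by (meson card_mono finite_subset)
  then have empty: "{S. A \<subseteq> S \<and> S \<subseteq> U \<and> card S = k} = {}"
    using False by auto
  show ?thesis unfolding empty using False by simp
qed

text \<open>
  In both counts a strip is given by the set of its rows. The rows in \<open>A\<close> are forced; all others are
  free except those in \<open>Suc ` B\<close>, respectively \<open>B\<close>. So there is one more free row on the left,
  and the identity is Pascal's rule.
\<close>

lemma card_strip_exchange:
  assumes l: "shape l" and n: "shape \<nu>"
  shows "card {\<mu> \<in> vertical_strips (Suc k) l. \<nu> \<in> interlacing \<mu>} =
    card {\<kappa> \<in> interlacing l. \<nu> \<in> vertical_strips (Suc k) \<kappa>} +
    card {\<kappa> \<in> interlacing l. \<nu> \<in> vertical_strips k \<kappa>}"
proof (cases "\<forall>i. l (Suc i) \<le> \<nu> i \<and> \<nu> i \<le> Suc (l i)")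
  case False
  \<comment> \<open>A violated bound excludes \<nu> on both sides: every \<nu> that is reached
    satisfies \<open>l (Suc i) \<le> \<nu> i \<le> Suc (l i)\<close> in every row. So all three sets
    are empty.\<close>
  then obtain i where i: "l (Suc i) > \<nu> i \<or> \<nu> i > Suc (l i)"
    by (meson not_le)
  have "{\<mu> \<in> vertical_strips k l. \<nu> \<in> interlacing \<mu>} = {}" for k
    using i by (auto simp: vertical_strips_def interlacing_def add_cells_def
        dest!: spec[of _ i] split: if_splits)
  note this[of "Suc k"]
  moreover have "{\<kappa> \<in> interlacing l. \<nu> \<in> vertical_strips k \<kappa>} = {}" for k
    using i by (auto simp: vertical_strips_def interlacing_def add_cells_def
        dest!: spec[of _ i] split: if_splits)
  note this[of "Suc k"] this[of k]
  ultimately show ?thesis by (simp only: card.empty)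
next
  case True
  define A where "A = {i. \<nu> i = Suc (l i)}"
  define B where "B = {i. \<nu> i = l (Suc i)}"
  have lS: "l (Suc i) \<le> l i" "\<nu> (Suc i) \<le> \<nu> i" for i
    using shape_le[OF l, of i "Suc i"] shape_le[OF n, of i "Suc i"] by auto
  \<comment> \<open>Beyond both shapes \<open>\<nu> i\<close> and \<open>l (Suc i)\<close> are 0, so
    \<open>B\<close> contains all but finitely many rows.\<close>
  have finB: "finite (- B)"
  proof -
    obtain m where m: "\<And>i. i \<ge> m \<Longrightarrow> l i = 0"
      using shape_eventually_0[OF l] by blast
    obtain m' where m': "\<And>i. i \<ge> m' \<Longrightarrow> \<nu> i = 0"
      using shape_eventually_0[OF n] by blast
    have "- B \<subseteq> {..<max m m'}"
      using m m' by (auto simp: B_def subset_iff not_le[symmetric])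
    then show ?thesis by (rule finite_subset) simp
  qed
  \<comment> \<open>Row 0 is not a successor, which makes it the one additional row in the left
    count.\<close>
  have U: "- (Suc ` B) = insert 0 (Suc ` (- B))"
  proof (rule set_eqI)
    fix i show "i \<in> - (Suc ` B) \<longleftrightarrow> i \<in> insert 0 (Suc ` (- B))" by (cases i) auto
  qed
  have finU: "finite (- (Suc ` B))" unfolding U using finB by simp
  have cardU: "card (- (Suc ` B)) = Suc (card (- B))"
    unfolding U using finB by (subst card_insert_disjoint) (auto simp: card_image)
  have AB: "A \<subseteq> - B" using lS(1) by (auto simp: A_def B_def) (metis Suc_n_not_le_n)
  have AU: "A \<subseteq> - (Suc ` B)"
    using lS(2) by (auto simp: A_def B_def) (metis Suc_n_not_le_n)
  have sub: "add_cells l S (Suc i) \<le> \<nu> i \<and> \<nu> i \<le> add_cells l S i"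
    if "A \<subseteq> S" "S \<subseteq> - (Suc ` B)" for S i
    using that True[rule_format, of i] by (force simp: A_def B_def le_Suc_eq add_cells_def)
  have "bij_betw (add_cells l) {S. A \<subseteq> S \<and> S \<subseteq> - (Suc ` B) \<and> card S = k}
      {\<mu> \<in> vertical_strips k l. \<nu> \<in> interlacing \<mu>}" for k
  proof (rule bij_betw_imageI)
    show "inj_on (add_cells l) {S. A \<subseteq> S \<and> S \<subseteq> - (Suc ` B) \<and> card S = k}"
      by (rule inj_onI) (auto simp: add_cells_def fun_eq_iff split: if_splits)
    show "add_cells l ` {S. A \<subseteq> S \<and> S \<subseteq> - (Suc ` B) \<and> card S = k} =
        {\<mu> \<in> vertical_strips k l. \<nu> \<in> interlacing \<mu>}"
    proof (intro equalityI subsetI)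
      fix \<mu> assume "\<mu> \<in> add_cells l ` {S. A \<subseteq> S \<and> S \<subseteq> - (Suc ` B) \<and> card S = k}"
      then obtain S where S: "A \<subseteq> S" "S \<subseteq> - (Suc ` B)" "card S = k" "\<mu> = add_cells l S"
        by auto
      have inter: "\<nu> \<in> interlacing \<mu>"
        using sub[OF S(1,2)] by (auto simp: interlacing_def S(4))
      then have mono: "\<mu> (Suc i) \<le> \<nu> i" "\<nu> i \<le> \<mu> i" for i
        by (auto simp: interlacing_def)
      obtain m where "\<nu> m = 0" using n by (auto simp: shape_def)
      \<comment> \<open>The chain \<open>\<mu> (Suc i) \<le> \<nu> i \<le> \<mu> i\<close> makes
        \<mu> weakly decreasing.\<close>
      then have "shape \<mu>"
        using mono by (intro shapeI[of _ "Suc m"]) (auto intro: le_trans, metis le_zero_eq)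
      then show "\<mu> \<in> {\<mu> \<in> vertical_strips k l. \<nu> \<in> interlacing \<mu>}"
        using inter S finite_subset[OF S(2) finU] by (auto simp: vertical_strips_def)
    next
      fix \<mu> assume "\<mu> \<in> {\<mu> \<in> vertical_strips k l. \<nu> \<in> interlacing \<mu>}"
      then obtain S where S: "finite S" "card S = k" "\<mu> = add_cells l S" "\<nu> \<in> interlacing \<mu>"
        by (auto simp: vertical_strips_def)
      have *: "add_cells l S (Suc i) \<le> \<nu> i" "\<nu> i \<le> add_cells l S i" for i
        using S(3,4) by (auto simp: interlacing_def)
      have "A \<subseteq> S" using *(2) by (fastforce simp: A_def add_cells_def split: if_splits)
      moreover have "Suc i \<notin> S" if "i \<in> B" for i
        using *(1)[of i] that by (auto simp: B_def add_cells_def)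
      then have "S \<subseteq> - (Suc ` B)" by auto
      ultimately show "\<mu> \<in> add_cells l ` {S. A \<subseteq> S \<and> S \<subseteq> - (Suc ` B) \<and> card S = k}"
        using S by auto
    qed
  qed
  then have L: "card {\<mu> \<in> vertical_strips k l. \<nu> \<in> interlacing \<mu>} =
      card {S. A \<subseteq> S \<and> S \<subseteq> - (Suc ` B) \<and> card S = k}" for k
    by (rule bij_betw_same_card[symmetric])
  \<comment> \<open>This makes \<open>\<nu> i - 1\<close> below a true subtraction, so that \<nu>
    and \<open>S\<close> determine \<kappa> and conversely.\<close>
  have pos: "\<nu> i > 0" if "i \<notin> B" for i
    using True[rule_format, of i] that by (cases "\<nu> i") (auto simp: B_def)
  let ?rem = "\<lambda>S i. if i \<in> S then \<nu> i - 1 else \<nu> i"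
  have "bij_betw ?rem {S. A \<subseteq> S \<and> S \<subseteq> - B \<and> card S = k}
      {\<kappa> \<in> interlacing l. \<nu> \<in> vertical_strips k \<kappa>}" for k
  proof (rule bij_betw_imageI)
    show "inj_on ?rem {S. A \<subseteq> S \<and> S \<subseteq> - B \<and> card S = k}"
    proof (rule inj_onI)
      fix S S' assume S: "S \<in> {S. A \<subseteq> S \<and> S \<subseteq> - B \<and> card S = k}"
        "S' \<in> {S. A \<subseteq> S \<and> S \<subseteq> - B \<and> card S = k}" "?rem S = ?rem S'"
      have "i \<in> S \<longleftrightarrow> i \<in> S'" for i
        using S(1,2) pos[of i] fun_cong[OF S(3), of i] by (auto split: if_splits)
      then show "S = S'" by blast
    qed
    show "?rem ` {S. A \<subseteq> S \<and> S \<subseteq> - B \<and> card S = k} =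
        {\<kappa> \<in> interlacing l. \<nu> \<in> vertical_strips k \<kappa>}"
    proof (intro equalityI subsetI)
      fix \<kappa> assume "\<kappa> \<in> ?rem ` {S. A \<subseteq> S \<and> S \<subseteq> - B \<and> card S = k}"
      then obtain S where S: "A \<subseteq> S" "S \<subseteq> - B" "card S = k" "\<kappa> = ?rem S"
        by auto
      have "l (Suc i) \<le> \<kappa> i \<and> \<kappa> i \<le> l i" for i
        using True[rule_format, of i] S(1,2) unfolding S(4)
        by (force simp: A_def B_def le_Suc_eq)
      then have "\<kappa> \<in> interlacing l" by (simp add: interlacing_def)
      moreover have "\<nu> = add_cells \<kappa> S"
        using S(2) pos unfolding S(4) by (fastforce simp: add_cells_def fun_eq_iff)
      ultimately show "\<kappa> \<in> {\<kappa> \<in> interlacing l. \<nu> \<in> vertical_strips k \<kappa>}"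
        using n S finite_subset[OF S(2) finB] by (auto simp: vertical_strips_def)
    next
      fix \<kappa> assume "\<kappa> \<in> {\<kappa> \<in> interlacing l. \<nu> \<in> vertical_strips k \<kappa>}"
      then obtain S where S: "finite S" "card S = k" "\<nu> = add_cells \<kappa> S" "\<kappa> \<in> interlacing l"
        by (auto simp: vertical_strips_def)
      have *: "l (Suc i) \<le> \<kappa> i" "\<kappa> i \<le> l i" for i
        using S(4) by (auto simp: interlacing_def)
      have "i \<in> S" if "i \<in> A" for i
        using *(2)[of i] that by (auto simp: A_def S(3) add_cells_def split: if_splits)
      moreover have "i \<notin> B" if "i \<in> S" for i
        using *(1)[of i] that by (auto simp: B_def S(3) add_cells_def)
      ultimately have "A \<subseteq> S" "S \<subseteq> - B" by blast+
      moreover have "\<kappa> = ?rem S" by (auto simp: S(3) add_cells_def)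
      ultimately show "\<kappa> \<in> ?rem ` {S. A \<subseteq> S \<and> S \<subseteq> - B \<and> card S = k}"
        using S by blast
    qed
  qed
  then have R: "card {\<kappa> \<in> interlacing l. \<nu> \<in> vertical_strips k \<kappa>} =
      card {S. A \<subseteq> S \<and> S \<subseteq> - B \<and> card S = k}" for k
    by (rule bij_betw_same_card[symmetric])
  have le: "card A \<le> card (- B)" using AB finB by (rule card_mono[rotated])
  \<comment> \<open>Pascal's rule with upper index \<open>card (- B) - card A\<close>. If
    \<open>card A = Suc k\<close>, the first two counts are 1 and the last is 0; for larger
    \<open>A\<close> all vanish.\<close>
  show ?thesis
    unfolding L R card_subsets_between[OF finU AU] card_subsets_between[OF finB AB] cardU
    using le by (auto simp: Suc_diff_le le_Suc_eq)
qed

text \<open>Induction on \<open>N\<close>. The branching rule and the induction hypothesis turn both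
  sides into sums of powers of \<open>x (Suc N)\<close> times Schur polynomials in \<open>N\<close>
  variables, and \<open>card_strip_exchange\<close> says that the multiplicities agree.\<close>

lemma dual_pieri:
  assumes "shape l"
  shows "elementary x N k * schur_poly x N l = (\<Sum>\<mu>\<in>vertical_strips k l. schur_poly x N \<mu>)"
  using assms
proof (induction N arbitrary: k l)
  case 0
  show ?case
  proof (cases "k = 0")
    case True
    then show ?thesis using 0 by (simp add: vertical_strips_0)
  next
    case False
    have "\<mu> \<noteq> (\<lambda>_. 0)" if "\<mu> \<in> vertical_strips k l" for \<mu>
    proof
      assume "\<mu> = (\<lambda>_. 0)"
      then have "card (diagram \<mu>) = 0" by (simp add: diagram_def)
      then show False using card_diagram_vertical_strips[OF 0 that] False by simp
    qed
    then show ?thesis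
      using False by (simp add: elementary_no_variables schur_poly_no_variables)
  qed
next
  case (Suc N)
  note l = Suc.prems
  show ?case
  proof (cases k)
    case 0
    then show ?thesis using l by (simp add: vertical_strips_0)
  next
    case (Suc j)
    let ?s = "schur_poly x N"
    let ?d = "\<lambda>l. card (diagram l)"
    let ?y = "x (Suc N)"
    \<comment> \<open>The final shape has \<open>?d l + k\<close> cells, and those outside \<nu>
      carry the last variable. This weight depends on \<nu> alone, so it remains to count the
      intermediate shapes.\<close>
    let ?p = "\<lambda>\<nu>. ?y ^ (?d l + k - ?d \<nu>) * ?s \<nu>"
    let ?V = "\<lambda>k \<nu>. {\<kappa> \<in> interlacing l. \<nu> \<in> vertical_strips k \<kappa>}"
    \<comment> \<open>A finite set containing every \<nu> that occurs on either side, so that the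
      double sums can be interchanged.\<close>
    define W where "W = (\<Union>\<mu>\<in>vertical_strips k l. interlacing \<mu>) \<union>
      (\<Union>\<kappa>\<in>interlacing l. vertical_strips k \<kappa> \<union> vertical_strips j \<kappa>)"
    have \<kappa>s: "shape \<kappa>" if "\<kappa> \<in> interlacing l" for \<kappa> using shape_interlacing[OF l that] .
    have finW: "finite W"
      unfolding W_def using finite_vertical_strips finite_interlacing l \<kappa>s shape_vertical_strips
      by auto
    have Ws: "shape \<nu>" if "\<nu> \<in> W" for \<nu>
      using that unfolding W_def by (blast intro: shape_vertical_strips shape_interlacing)
    have "(\<Sum>\<mu>\<in>vertical_strips k l. schur_poly x (Suc N) \<mu>) =
        (\<Sum>\<mu>\<in>vertical_strips k l. \<Sum>\<nu> | \<nu> \<in> W \<and> \<nu> \<in> interlacing \<mu>. ?p \<nu>)"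
    proof (rule sum.cong[OF refl])
      fix \<mu> assume \<mu>: "\<mu> \<in> vertical_strips k l"
      then have "{\<nu>. \<nu> \<in> W \<and> \<nu> \<in> interlacing \<mu>} = interlacing \<mu>"
        by (auto simp: W_def)
      then show "schur_poly x (Suc N) \<mu> = (\<Sum>\<nu> | \<nu> \<in> W \<and> \<nu> \<in> interlacing \<mu>. ?p \<nu>)"
        using schur_poly_Suc_variables[OF shape_vertical_strips[OF \<mu>], of x N]
          card_diagram_vertical_strips[OF l \<mu>] by simp
    qed
    also have "\<dots> = (\<Sum>\<nu>\<in>W. \<Sum>\<mu> | \<mu> \<in> vertical_strips k l \<and> \<nu> \<in> interlacing \<mu>. ?p \<nu>)"
      by (rule sum.swap_restrict[OF finite_vertical_strips[OF l] finW])
    also have "\<dots> = (\<Sum>\<nu>\<in>W. of_nat (card {\<mu> \<in> vertical_strips k l. \<nu> \<in> interlacing \<mu>}) * ?p \<nu>)"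
      by simp
    also have "\<dots> = (\<Sum>\<nu>\<in>W. of_nat (card (?V k \<nu>)) * ?p \<nu>) + (\<Sum>\<nu>\<in>W. of_nat (card (?V j \<nu>)) * ?p \<nu>)"
      unfolding sum.distrib[symmetric]
      by (rule sum.cong[OF refl])
        (simp only: Suc card_strip_exchange[OF l Ws] of_nat_add distrib_right)
    finally have right: "(\<Sum>\<mu>\<in>vertical_strips k l. schur_poly x (Suc N) \<mu>) = \<dots>" .
    \<comment> \<open>The case \<open>i = k\<close> belongs to the subsets avoiding
      \<open>Suc N\<close> in \<open>elementary_Suc_variables\<close>, the case \<open>i = j\<close>
      to those containing it, whose factor \<open>?y\<close> raises the exponent by
      \<open>k - j = 1\<close>.\<close>
    have left: "(\<Sum>\<kappa>\<in>interlacing l. ?y ^ (?d l + k - (?d \<kappa> + i)) * (elementary x N i * ?s \<kappa>)) =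
        (\<Sum>\<nu>\<in>W. of_nat (card (?V i \<nu>)) * ?p \<nu>)" if i: "i = k \<or> i = j" for i
    proof -
      have "(\<Sum>\<kappa>\<in>interlacing l. ?y ^ (?d l + k - (?d \<kappa> + i)) * (elementary x N i * ?s \<kappa>)) =
          (\<Sum>\<kappa>\<in>interlacing l. \<Sum>\<nu> | \<nu> \<in> W \<and> \<nu> \<in> vertical_strips i \<kappa>. ?p \<nu>)"
      proof (rule sum.cong[OF refl])
        fix \<kappa> assume \<kappa>: "\<kappa> \<in> interlacing l"
        then have "{\<nu>. \<nu> \<in> W \<and> \<nu> \<in> vertical_strips i \<kappa>} = vertical_strips i \<kappa>"
          using i by (auto simp: W_def)
        then show "?y ^ (?d l + k - (?d \<kappa> + i)) * (elementary x N i * ?s \<kappa>) =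
            (\<Sum>\<nu> | \<nu> \<in> W \<and> \<nu> \<in> vertical_strips i \<kappa>. ?p \<nu>)"
          using Suc.IH[OF \<kappa>s[OF \<kappa>], of i] card_diagram_vertical_strips[OF \<kappa>s[OF \<kappa>], of _ i]
          by (simp add: sum_distrib_left)
      qed
      also have "\<dots> = (\<Sum>\<nu>\<in>W. \<Sum>\<kappa> | \<kappa> \<in> interlacing l \<and> \<nu> \<in> vertical_strips i \<kappa>. ?p \<nu>)"
        by (rule sum.swap_restrict[OF finite_interlacing[OF l] finW])
      finally show ?thesis by simp
    qed
    have "elementary x (Suc N) k * schur_poly x (Suc N) l =
        (\<Sum>\<kappa>\<in>interlacing l. ?y ^ (?d l + k - (?d \<kappa> + k)) * (elementary x N k * ?s \<kappa>)) +
        (\<Sum>\<kappa>\<in>interlacing l. ?y ^ (?d l + k - (?d \<kappa> + j)) * (elementary x N j * ?s \<kappa>))"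
      unfolding schur_poly_Suc_variables[OF l] Suc elementary_Suc_variables
        sum_distrib_left sum.distrib[symmetric]
    proof (rule sum.cong[OF refl])
      fix \<kappa> assume "\<kappa> \<in> interlacing l"
      then have "?d \<kappa> \<le> ?d l" using card_diagram_interlacing[OF l] by simp
      then have "?d l + Suc j - (?d \<kappa> + j) = Suc (?d l - ?d \<kappa>)" by simp
      then show "(elementary x N (Suc j) + ?y * elementary x N j) * (?y ^ (?d l - ?d \<kappa>) * ?s \<kappa>) =
          ?y ^ (?d l + Suc j - (?d \<kappa> + Suc j)) * (elementary x N (Suc j) * ?s \<kappa>) +
          ?y ^ (?d l + Suc j - (?d \<kappa> + j)) * (elementary x N j * ?s \<kappa>)"
        by (simp add: algebra_simps)
    qed
    then show ?thesis
      unfolding right left[OF disjI1[OF refl]] left[OF disjI2[OF refl]] .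
  qed
qed

subsection \<open>Paths\<close>

definition smirnov_words :: "nat \<Rightarrow> nat \<Rightarrow> nat list set" where
  "smirnov_words N n = {w. length w = n \<and> set w \<subseteq> {1..N} \<and> distinct_adj w}"

text \<open>The chromatic symmetric function of the path on \<open>n\<close> vertices in
  \<open>N\<close> variables, a coloring being read as a word along the path.\<close>

definition path_poly :: "(nat \<Rightarrow> 'a::comm_ring_1) \<Rightarrow> nat \<Rightarrow> nat \<Rightarrow> 'a" where
  "path_poly x N n = (\<Sum>w\<in>smirnov_words N n. prod_list (map x w))"

lemma finite_smirnov_words: "finite (smirnov_words N n)"
  by (rule finite_subset[OF _ finite_lists_length_eq[of "{1..N}" n]])
    (auto simp: smirnov_words_def)

lemma smirnov_words_0: "smirnov_words N 0 = {[]}"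
  by (auto simp: smirnov_words_def)

lemma path_poly_0 [simp]: "path_poly x N 0 = 1"
  by (simp add: path_poly_def smirnov_words_0)

text \<open>For fixed \<open>k + m\<close> these pairs interpolate between words
  (\<open>k = 0\<close>) and sets (\<open>m = 0\<close>).\<close>

definition avoiding_pairs :: "nat \<Rightarrow> nat \<Rightarrow> nat \<Rightarrow> (nat set \<times> nat list) set" where
  "avoiding_pairs N k m =
    {(S, w). S \<subseteq> {1..N} \<and> card S = k \<and> w \<in> smirnov_words N m \<and> (w = [] \<or> hd w \<notin> S)}"

definition avoiding_poly :: "(nat \<Rightarrow> 'a::comm_ring_1) \<Rightarrow> nat \<Rightarrow> nat \<Rightarrow> nat \<Rightarrow> 'a" where
  "avoiding_poly x N k m = (\<Sum>(S, w)\<in>avoiding_pairs N k m. prod x S * prod_list (map x w))"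

lemma avoiding_poly_no_set: "avoiding_poly x N 0 n = path_poly x N n"
proof -
  have "avoiding_pairs N 0 n = {{}} \<times> smirnov_words N n"
    by (auto simp: avoiding_pairs_def dest: finite_subset)
  then show ?thesis
    by (simp add: avoiding_poly_def path_poly_def sum.cartesian_product[symmetric])
qed

lemma avoiding_poly_no_word: "avoiding_poly x N k 0 = elementary x N k"
proof -
  have "avoiding_pairs N k 0 = {S. S \<subseteq> {1..N} \<and> card S = k} \<times> {[]}"
    by (auto simp: avoiding_pairs_def smirnov_words_0)
  then show ?thesis
    by (simp add: avoiding_poly_def elementary_def sum.cartesian_product[symmetric])
qed

text \<open>
  Mark an element of the set and move it to the front of the word; this fails only for the pairs
  whose word starts with the marked element.
\<close>

lemma elementary_path_telescope:
  "of_nat k * elementary x N (Suc k) * path_poly x N m =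
    avoiding_poly x N k (Suc m) - avoiding_poly x N (Suc k) m"
proof -
  let ?A = "{S. S \<subseteq> {1..N} \<and> card S = Suc k}"
  let ?B = "smirnov_words N m"
  let ?w = "\<lambda>(S, w). prod x S * prod_list (map x w)"
  let ?hit = "\<lambda>(S, w). w \<noteq> [] \<and> hd w \<in> S"
  let ?G = "\<Sum>q | q \<in> ?A \<times> ?B \<and> ?hit q. ?w q"
  have fin: "finite (?A \<times> ?B)"
    using finite_smirnov_words by simp
  have finS: "finite S" if "S \<subseteq> {1..N}" for S
    using that finite_subset by blast
  have prod: "elementary x N (Suc k) * path_poly x N m = (\<Sum>q\<in>?A \<times> ?B. ?w q)"
    by (simp add: elementary_def path_poly_def sum_product sum.cartesian_product)
  have "(\<Sum>q\<in>?A \<times> ?B. ?w q) = ?G + (\<Sum>q | q \<in> ?A \<times> ?B \<and> \<not> ?hit q. ?w q)"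
    using fin by (subst sum.union_disjoint[symmetric]) (auto intro!: sum.cong)
  also have "{q. q \<in> ?A \<times> ?B \<and> \<not> ?hit q} = avoiding_pairs N (Suc k) m"
    by (auto simp: avoiding_pairs_def)
  finally have unmarked: "elementary x N (Suc k) * path_poly x N m = ?G + avoiding_poly x N (Suc k) m"
    by (simp add: prod avoiding_poly_def)
  let ?j = "\<lambda>((S, w), c). (S - {c}, c # w)"
  let ?i = "\<lambda>(R, v). ((insert (hd v) R, tl v), hd v)"
  let ?free = "\<lambda>(S, w). {c \<in> S. w = [] \<or> hd w \<noteq> c}"
  \<comment> \<open>Each pair allows \<open>Suc k\<close> marks, and all of them are free except
    \<open>hd w\<close> when it lies in the set.\<close>
  have free: "of_nat (Suc k) * ?w q = (\<Sum>c\<in>?free q. ?w q) + (if ?hit q then ?w q else 0)"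
    if q: "q \<in> ?A \<times> ?B" for q
  proof -
    obtain S w where q': "q = (S, w)" "card S = Suc k" "finite S"
      using q finS by auto
    have "card S = card (?free q) + of_bool (?hit q)"
    proof (cases "?hit q")
      case True
      then have "?free q = S - {hd w}" using q' by auto
      then show ?thesis using True q' by (simp add: card_Diff_singleton)
    next
      case False
      then have "?free q = S" using q' by auto
      then show ?thesis using False by simp
    qed
    then have "of_nat (Suc k) = (of_nat (card (?free q)) :: 'a) + of_bool (?hit q)"
      using arg_cong[of _ _ "of_nat :: nat \<Rightarrow> 'a"] by (simp only: q'(2) of_nat_add of_nat_of_bool)
    then show ?thesis by (simp only: distrib_right sum_constant) simp
  qed
  have "of_nat (Suc k) * (elementary x N (Suc k) * path_poly x N m) =
      (\<Sum>q\<in>?A \<times> ?B. \<Sum>c\<in>?free q. ?w q) + (\<Sum>q\<in>?A \<times> ?B. if ?hit q then ?w q else 0)"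
    unfolding prod sum_distrib_left sum.distrib[symmetric] by (rule sum.cong[OF refl free])
  also have "(\<Sum>q\<in>?A \<times> ?B. if ?hit q then ?w q else 0) = ?G"
    using fin by (simp add: sum.If_cases Collect_conj_eq)
  also have "(\<Sum>q\<in>?A \<times> ?B. \<Sum>c\<in>?free q. ?w q) = (\<Sum>(q, c)\<in>Sigma (?A \<times> ?B) ?free. ?w q)"
    using fin finS by (subst sum.Sigma) auto
  also have "\<dots> = avoiding_poly x N k (Suc m)"
    unfolding avoiding_poly_def
  proof (rule sum.reindex_bij_witness[where j = ?j and i = ?i])
    fix t assume "t \<in> Sigma (?A \<times> ?B) ?free"
    then obtain S w c where t: "t = ((S, w), c)" "S \<subseteq> {1..N}" "card S = Suc k" "w \<in> ?B"
      "c \<in> S" "w = [] \<or> hd w \<noteq> c" by auto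
    show "?i (?j t) = t"
      using t by auto
    show "?j t \<in> avoiding_pairs N k (Suc m)"
      using t finS[OF t(2)]
      by (auto simp: avoiding_pairs_def smirnov_words_def distinct_adj_Cons card_Diff_singleton)
    show "?w (?j t) = (case t of (q, c) \<Rightarrow> ?w q)"
      using t finS[OF t(2)] prod.remove[of S c x] by (simp add: mult_ac)
  next
    fix t assume "t \<in> avoiding_pairs N k (Suc m)"
    then obtain R c w where t: "t = (R, c # w)" "R \<subseteq> {1..N}" "card R = k"
      "c # w \<in> smirnov_words N (Suc m)" "c \<notin> R"
      by (auto simp: avoiding_pairs_def smirnov_words_def length_Suc_conv)
    show "?j (?i t) = t"
      using t by auto
    show "?i t \<in> Sigma (?A \<times> ?B) ?free"
      using t finS[OF t(2)] by (auto simp: smirnov_words_def distinct_adj_Cons)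
  qed
  \<comment> \<open>Subtracting \<open>unmarked\<close> cancels \<open>?G\<close> and lowers the
    factor \<open>Suc k\<close> to \<open>k\<close>.\<close>
  finally show ?thesis
    using unmarked by (simp add: algebra_simps)
qed

text \<open>The sum of \<open>elementary_path_telescope\<close> over all pairs of total degree
  \<open>n\<close> telescopes, with the path polynomial at one end and the elementary one at the
  other.\<close>

lemma path_poly_recurrence:
  "path_poly x N n = elementary x N n +
    (\<Sum>k<n. of_nat k * elementary x N (Suc k) * path_poly x N (n - Suc k))"
proof -
  have "(\<Sum>k<n. of_nat k * elementary x N (Suc k) * path_poly x N (n - Suc k)) =
      (\<Sum>k<n. avoiding_poly x N k (n - k) - avoiding_poly x N (Suc k) (n - Suc k))"
    by (intro sum.cong) (auto simp: elementary_path_telescope Suc_diff_Suc)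
  also have "\<dots> = path_poly x N n - elementary x N n"
    by (subst sum_lessThan_telescope') (simp add: avoiding_poly_no_set avoiding_poly_no_word)
  finally show ?thesis by simp
qed

subsection \<open>Spiders with a leg of length one\<close>

text \<open>Join the two words. If the adjacent end letters differ, the result is a word of length
  \<open>a + b + 2\<close>; if they agree, merge them into the letter at position \<open>a\<close>,
  whose variable is then counted twice.\<close>

lemma path_poly_product:
  "path_poly x N (Suc a) * path_poly x N (Suc b) = path_poly x N (a + b + 2) +
    (\<Sum>w\<in>smirnov_words N (a + b + 1). x (w ! a) * prod_list (map x w))"
proof -
  let ?C = "smirnov_words N (Suc a) \<times> smirnov_words N (Suc b)"
  let ?w = "\<lambda>(u, v). prod_list (map x u) * prod_list (map x v)"
  let ?eq = "\<lambda>(u, v). last u = hd v"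
  have fin: "finite ?C" using finite_smirnov_words by simp
  have "path_poly x N (Suc a) * path_poly x N (Suc b) = (\<Sum>q\<in>?C. ?w q)"
    by (simp add: path_poly_def sum_product sum.cartesian_product)
  also have "\<dots> = (\<Sum>q | q \<in> ?C \<and> \<not> ?eq q. ?w q) + (\<Sum>q | q \<in> ?C \<and> ?eq q. ?w q)"
    using fin by (subst sum.union_disjoint[symmetric]) (auto intro!: sum.cong)
  also have "(\<Sum>q | q \<in> ?C \<and> \<not> ?eq q. ?w q) = path_poly x N (a + b + 2)"
    unfolding path_poly_def
  proof (rule sum.reindex_bij_witness[where
        j = "\<lambda>(u, v). u @ v" and i = "\<lambda>w. (take (Suc a) w, drop (Suc a) w)"])
    fix w assume w: "w \<in> smirnov_words N (a + b + 2)"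
    define u v where "u = take (Suc a) w" and "v = drop (Suc a) w"
    have uv: "w = u @ v" "length u = Suc a" "length v = Suc b" "u \<noteq> []" "v \<noteq> []"
      using w by (auto simp: u_def v_def smirnov_words_def simp del: take_Suc drop_Suc)
    then have "(u, v) \<in> {q. q \<in> ?C \<and> \<not> ?eq q}"
      using w by (auto simp: smirnov_words_def distinct_adj_append_iff)
    then show "(take (Suc a) w, drop (Suc a) w) \<in> {q. q \<in> ?C \<and> \<not> ?eq q}"
      by (simp only: u_def v_def)
  next
    fix q assume "q \<in> {q. q \<in> ?C \<and> \<not> ?eq q}"
    then show "(case q of (u, v) \<Rightarrow> u @ v) \<in> smirnov_words N (a + b + 2)"
      by (auto simp: smirnov_words_def distinct_adj_append_iff)
  qed (auto simp: smirnov_words_def simp del: take_Suc drop_Suc)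
  also have "(\<Sum>q | q \<in> ?C \<and> ?eq q. ?w q) =
      (\<Sum>w\<in>smirnov_words N (a + b + 1). x (w ! a) * prod_list (map x w))"
  proof (rule sum.reindex_bij_witness[where
        j = "\<lambda>(u, v). u @ tl v" and i = "\<lambda>w. (take (Suc a) w, w ! a # drop (Suc a) w)"])
    fix w assume w: "w \<in> smirnov_words N (a + b + 1)"
    define u v where "u = take (Suc a) w" and "v = drop (Suc a) w"
    have uv: "w = u @ v" "length u = Suc a" "length v = b" "u \<noteq> []"
      using w by (auto simp: u_def v_def smirnov_words_def simp del: take_Suc drop_Suc)
    have wa: "w ! a = last u"
      using uv by (simp add: last_conv_nth nth_append)
    have "last u \<in> set u" "set u \<subseteq> {1..N}" using uv w by (auto simp: smirnov_words_def)
    then have "last u \<in> {1..N}" by blast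
    then have "(u, last u # v) \<in> {q. q \<in> ?C \<and> ?eq q}"
      using w uv by (auto simp: smirnov_words_def distinct_adj_append_iff distinct_adj_Cons)
    then show "(take (Suc a) w, w ! a # drop (Suc a) w) \<in> {q. q \<in> ?C \<and> ?eq q}"
      by (simp only: u_def v_def wa)
  next
    fix q assume "q \<in> {q. q \<in> ?C \<and> ?eq q}"
    then obtain u c v where q: "q = (u, c # v)" "u \<in> smirnov_words N (Suc a)"
      "c # v \<in> smirnov_words N (Suc b)" "last u = c"
      by (auto simp: smirnov_words_def length_Suc_conv)
    have u: "length u = Suc a" "u \<noteq> []" using q by (auto simp: smirnov_words_def)
    have nth: "(u @ v) ! a = c" using u q by (simp add: nth_append last_conv_nth)
    show "(case q of (u, v) \<Rightarrow> u @ tl v) \<in> smirnov_words N (a + b + 1)"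
      using q by (auto simp: smirnov_words_def distinct_adj_append_iff distinct_adj_Cons)
    show "(take (Suc a) (case q of (u, v) \<Rightarrow> u @ tl v), (case q of (u, v) \<Rightarrow> u @ tl v) ! a #
        drop (Suc a) (case q of (u, v) \<Rightarrow> u @ tl v)) = q"
      using q u nth by (simp del: take_Suc drop_Suc)
    show "x ((case q of (u, v) \<Rightarrow> u @ tl v) ! a) *
        prod_list (map x (case q of (u, v) \<Rightarrow> u @ tl v)) = ?w q"
      using q nth by (simp add: mult_ac)
  qed (auto simp: smirnov_words_def simp del: take_Suc drop_Suc)
  finally show ?thesis .
qed

lemma elementary_1: "elementary x N (Suc 0) = (\<Sum>c\<in>{1..N}. x c)"
proof -
  have "elementary x N (Suc 0) = (\<Sum>S\<in>(\<lambda>c. {c}) ` {1..N}. prod x S)"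
    unfolding elementary_def by (rule sum.cong) (auto simp: card_Suc_eq)
  then show ?thesis by (simp add: sum.reindex)
qed

text \<open>The word colors the path formed by the two long legs, with the centre at position
  \<open>a\<close>; \<open>c\<close> is the color of the leaf on the leg of length one.\<close>

definition spider_words :: "nat \<Rightarrow> nat \<Rightarrow> nat \<Rightarrow> (nat list \<times> nat) set" where
  "spider_words N a b = {(w, c). w \<in> smirnov_words N (a + b + 1) \<and> c \<in> {1..N} \<and> c \<noteq> w ! a}"

text \<open>The leaf takes every color but that of the centre. The excluded choices are the words
  with their letter at position \<open>a\<close> doubled, which \<open>path_poly_product\<close>
  evaluates.\<close>

lemma sum_spider_words:
  "(\<Sum>(w, c)\<in>spider_words N a b. prod_list (map x w) * x c) =
    path_poly x N (a + b + 2) + elementary x N (Suc 0) * path_poly x N (a + b + 1)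
    - path_poly x N (Suc b) * path_poly x N (Suc a)"
proof -
  let ?W = "smirnov_words N (a + b + 1)"
  have nth: "w ! a \<in> {1..N}" if "w \<in> ?W" for w
  proof -
    have "w ! a \<in> set w" "set w \<subseteq> {1..N}" using that by (auto simp: smirnov_words_def)
    then show ?thesis by blast
  qed
  have "spider_words N a b = (SIGMA w:?W. {1..N} - {w ! a})"
    by (auto simp: spider_words_def)
  then have "(\<Sum>(w, c)\<in>spider_words N a b. prod_list (map x w) * x c) =
      (\<Sum>w\<in>?W. \<Sum>c\<in>{1..N} - {w ! a}. prod_list (map x w) * x c)"
    using finite_smirnov_words by (simp add: sum.Sigma)
  also have "\<dots> = (\<Sum>w\<in>?W. elementary x N (Suc 0) * prod_list (map x w)
      - x (w ! a) * prod_list (map x w))"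
  proof (rule sum.cong[OF refl])
    fix w assume "w \<in> ?W"
    then show "(\<Sum>c\<in>{1..N} - {w ! a}. prod_list (map x w) * x c) =
        elementary x N (Suc 0) * prod_list (map x w) - x (w ! a) * prod_list (map x w)"
      using nth[of w]
      by (subst sum_distrib_left[symmetric]) (simp add: sum_diff1 elementary_1 algebra_simps)
  qed
  also have "\<dots> = elementary x N (Suc 0) * path_poly x N (a + b + 1) -
      (\<Sum>w\<in>?W. x (w ! a) * prod_list (map x w))"
    by (simp add: sum_subtractf sum_distrib_left path_poly_def)
  finally show ?thesis
    using path_poly_product[of x N a b] by (simp add: algebra_simps)
qed

section \<open>Colorings of the spider as words\<close>

definition bounded_colorings :: "nat \<Rightarrow> 'v graph \<Rightarrow> ('v \<Rightarrow> nat) set" where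
  "bounded_colorings N G = {c \<in> proper_colorings G. c ` fst G \<subseteq> {1..N}}"

lemma spider_vertices_1:
  "fst (spider [a, b, 1]) = {0} \<times> {..a} \<union> {1} \<times> {1..b} \<union> {(2, 1)}"
  unfolding spider_vertices
proof (intro equalityI subsetI)
  fix p assume "p \<in> insert (0, 0) ((\<lambda>(i, j). (i, Suc j)) ` cells [a, b, 1])"
  then show "p \<in> {0} \<times> {..a} \<union> {1} \<times> {1..b} \<union> {(2, 1)}"
    by (auto simp: cells_def less_Suc_eq numeral_2_eq_2)
next
  fix p :: "nat \<times> nat" assume "p \<in> {0} \<times> {..a} \<union> {1} \<times> {1..b} \<union> {(2, 1)}"
  then consider "p = (0, 0)" | i j where "p = (i, Suc j)" "(i, j) \<in> cells [a, b, 1]"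
    by (cases p; cases "snd p") (auto simp: cells_def)
  then show "p \<in> insert (0, 0) ((\<lambda>(i, j). (i, Suc j)) ` cells [a, b, 1])"
    by cases force+
qed

text \<open>Runs from the tip of the first leg (\<open>j = 0\<close>) through the centre
  (\<open>j = a\<close>) to the tip of the second leg (\<open>j = a + b\<close>), so the first leg
  is traversed backwards.\<close>

definition spine :: "nat \<Rightarrow> nat \<Rightarrow> nat \<times> nat" where
  "spine a j = (if j \<le> a then (0, a - j) else (1, j - a))"

lemma inj_spine: "inj_on (spine a) A"
  by (rule inj_onI) (auto simp: spine_def split: if_splits)

lemma spider_vertices_spine:
  "fst (spider [a, b, 1]) = insert (2, 1) (spine a ` {..<a + b + 1})"
proof -
  have "spine a ` {..<a + b + 1} = {0} \<times> {..a} \<union> {1} \<times> {1..b}"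
  proof (intro equalityI subsetI)
    fix p :: "nat \<times> nat" assume "p \<in> {0} \<times> {..a} \<union> {1} \<times> {1..b}"
    then consider j where "j \<le> a" "p = (0, j)" | j where "1 \<le> j" "j \<le> b" "p = (1, j)" by auto
    then show "p \<in> spine a ` {..<a + b + 1}"
    proof cases
      case 1
      then show ?thesis by (intro image_eqI[of _ _ "a - j"]) (auto simp: spine_def)
    next
      case 2
      then show ?thesis by (intro image_eqI[of _ _ "a + j"]) (auto simp: spine_def)
    qed
  qed (auto simp: spine_def split: if_splits)
  then show ?thesis unfolding spider_vertices_1 by auto
qed

text \<open>Every edge joins consecutive vertices of the spine, except the one from the leaf
  \<open>(2, 1)\<close> to the centre.\<close>

lemma spider_proper_iff:
  "(\<forall>u v. {u, v} \<in> snd (spider [a, b, 1]) \<longrightarrow> c u \<noteq> c v) \<longleftrightarrow>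
    (\<forall>j<a + b. c (spine a j) \<noteq> c (spine a (Suc j))) \<and> c (2, 1) \<noteq> c (spine a a)"
    (is "?proper \<longleftrightarrow> ?path")
proof
  assume p: ?proper
  have edge: "c (spider_glue (i, j)) \<noteq> c (spider_glue (i, Suc j))"
    if "i < 3" "j < [a, b, 1] ! i" for i j
  proof -
    have "{spider_glue (i, j), spider_glue (i, Suc j)} \<in> snd (spider [a, b, 1])"
      unfolding spider_def snd_conv using that by (intro CollectI exI[of _ i] exI[of _ j]) simp
    then show ?thesis using p by blast
  qed
  have "c (spine a j) \<noteq> c (spine a (Suc j))" if "j < a + b" for j
  proof (cases "j < a")
    case True
    then have "Suc (a - Suc j) = a - j" by simp
    then show ?thesis
      using True edge[of 0 "a - Suc j"] by (auto simp: spine_def spider_glue_def split: if_splits)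
  next
    case False
    then have "j - a < b" using that by simp
    then show ?thesis
      using False edge[of 1 "j - a"] by (auto simp: spine_def spider_glue_def Suc_diff_le)
  qed
  moreover have "c (2, 1) \<noteq> c (spine a a)"
    using edge[of 2 0] by (auto simp: spine_def spider_glue_def)
  ultimately show ?path by blast
next
  assume p: ?path
  have "c (spider_glue (i, j)) \<noteq> c (spider_glue (i, Suc j))"
    if ij: "i < 3" "j < [a, b, 1] ! i" for i j
  proof -
    consider "i = 0" "j < a" | "i = 1" "j < b" | "i = 2" "j = 0"
      using ij by (auto simp: less_Suc_eq numeral_3_eq_3 numeral_2_eq_2)
    then show ?thesis
    proof cases
      case 1
      then have "c (spine a (a - Suc j)) \<noteq> c (spine a (a - j))"
        using p[THEN conjunct1, rule_format, of "a - Suc j"] by (simp add: Suc_diff_Suc)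
      then show ?thesis using 1 by (auto simp: spine_def spider_glue_def)
    next
      case 2
      then have "c (spine a (a + j)) \<noteq> c (spine a (Suc (a + j)))" using p by auto
      then show ?thesis using 2 by (auto simp: spine_def spider_glue_def split: if_splits)
    next
      case 3
      then show ?thesis using p by (auto simp: spine_def spider_glue_def)
    qed
  qed
  then show ?proper by (auto simp: spider_def doubleton_eq_iff) (metis numeral_3_eq_3)+
qed

lemma sum_bounded_colorings_spider:
  "(\<Sum>c\<in>bounded_colorings N (spider [a, b, 1]). \<Prod>v\<in>fst (spider [a, b, 1]). x (c v)) =
    (\<Sum>(w, p)\<in>spider_words N a b. prod_list (map x w) * x p)"
proof -
  let ?n = "a + b + 1"
  define G where "G = spider [a, b, 1]"
  let ?V = "fst G"
  note V = spider_vertices_spine[of a b, folded G_def]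
  let ?word = "\<lambda>c. map (\<lambda>j. c (spine a j)) [0..<?n]"
  \<comment> \<open>The inverse of reading off a coloring: \<open>the_inv\<close> gives the position
    of a spine vertex in the word, and restricting to \<open>?V\<close> makes the coloring
    extensional.\<close>
  define col where "col = (\<lambda>(w :: nat list, p). \<lambda>v\<in>?V. if v = (2, 1) then p else w ! the_inv (spine a) v)"
  have notin: "(2, 1) \<notin> spine a ` A" "spine a j \<noteq> (2, 1)" for A j
    by (auto simp: spine_def)
  have col_spine: "col (w, p) (spine a j) = w ! j" if "j < ?n" for w p j
    using that notin by (auto simp: col_def V the_inv_f_f[OF inj_spine])
  have col_leaf: "col (w, p) (2, 1) = p" for w p
    by (auto simp: col_def V)
  have memV: "v = (2, 1) \<or> (\<exists>j<?n. v = spine a j)" if "v \<in> ?V" for v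
    using that by (auto simp: V)
  have colorings: "c \<in> bounded_colorings N G \<longleftrightarrow>
      c \<in> extensional ?V \<and> (?word c, c (2, 1)) \<in> spider_words N a b" for c
  proof -
    have nth: "?word c ! a = c (spine a a)" by (simp add: nth_append del: upt_Suc)
    have "c \<in> bounded_colorings N G \<longleftrightarrow> c \<in> extensional ?V \<and> c ` ?V \<subseteq> {1..N} \<and>
        (\<forall>u v. {u, v} \<in> snd (G) \<longrightarrow> c u \<noteq> c v)"
      by (auto simp: bounded_colorings_def proper_colorings_def PiE_def)
    also have "c ` ?V \<subseteq> {1..N} \<longleftrightarrow> set (?word c) \<subseteq> {1..N} \<and> c (2, 1) \<in> {1..N}"
      unfolding V by (auto simp del: upt_Suc)
    finally show ?thesis
      unfolding spider_proper_iff[of a b, folded G_def] spider_words_def smirnov_words_def distinct_adj_conv_nth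
      using nth by (auto simp del: upt_Suc)
  qed
  show ?thesis
    unfolding G_def[symmetric]
  proof (rule sum.reindex_bij_witness[where j = "\<lambda>c. (?word c, c (2, 1))" and i = col])
    fix c assume c: "c \<in> bounded_colorings N G"
    show "col (?word c, c (2, 1)) = c"
    proof
      fix v show "col (?word c, c (2, 1)) v = c v"
      proof (cases "v \<in> ?V")
        case True
        then show ?thesis
          using memV[OF True] col_spine col_leaf by (auto simp del: upt_Suc)
      next
        case False
        have "c \<in> extensional ?V" using c unfolding colorings by (rule conjunct1)
        then have "c v = undefined" using False by (rule extensional_arb)
        then show ?thesis using False by (simp add: col_def)
      qed
    qed
    show "(?word c, c (2, 1)) \<in> spider_words N a b" using c unfolding colorings by (rule conjunct2)
    have "(\<Prod>v\<in>?V. x (c v)) = x (c (2, 1)) * (\<Prod>j<?n. x (c (spine a j)))"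
      unfolding V using notin(1)
      by (subst prod.insert) (auto simp: prod.reindex[OF inj_spine])
    also have "(\<Prod>j<?n. x (c (spine a j))) = prod_list (map x (?word c))"
      using prod.distinct_set_conv_list[of "[0..<?n]" "\<lambda>j. x (c (spine a j))"]
      by (simp add: atLeast0LessThan comp_def del: upt_Suc)
    finally show "(case (?word c, c (2, 1)) of (w, p) \<Rightarrow> prod_list (map x w) * x p) =
        (\<Prod>v\<in>?V. x (c v))"
      by (simp add: mult.commute del: upt_Suc)
  next
    fix q assume q: "q \<in> spider_words N a b"
    obtain w p where wp: "q = (w, p)" by (cases q)
    have len: "length w = ?n" using q wp by (auto simp: spider_words_def smirnov_words_def)
    have "?word (col q) = w"
      using len col_spine by (intro nth_equalityI) (auto simp: wp simp del: upt_Suc)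
    then show "(?word (col q), col q (2, 1)) = q" using wp col_leaf by simp
    then show "col q \<in> bounded_colorings N G"
      unfolding colorings using q by (auto simp: col_def wp)
  qed
qed

subsection \<open>Nonnegative combinations of Schur polynomials\<close>

text \<open>The combination \<open>M\<close> must not depend on the number \<open>N\<close> of variables.\<close>

definition schur_nonneg :: "(nat \<Rightarrow> 'a::comm_ring_1) \<Rightarrow> (nat \<Rightarrow> 'a) \<Rightarrow> bool" where
  "schur_nonneg x f \<longleftrightarrow>
    (\<exists>M. (\<forall>l\<in>#M. shape l) \<and> (\<forall>N. f N = (\<Sum>l\<in>#M. schur_poly x N l)))"

lemma schur_nonneg_0: "schur_nonneg x (\<lambda>N. 0)"
  unfolding schur_nonneg_def by (intro exI[of _ "{#}"]) simp

lemma schur_nonneg_schur_sum: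
  assumes "finite A" "\<And>l. l \<in> A \<Longrightarrow> shape l"
  shows "schur_nonneg x (\<lambda>N. \<Sum>l\<in>A. schur_poly x N l)"
  unfolding schur_nonneg_def using assms
  by (intro exI[of _ "mset_set A"]) (simp add: sum_unfold_sum_mset)

lemma schur_nonneg_add:
  assumes "schur_nonneg x f" "schur_nonneg x g"
  shows "schur_nonneg x (\<lambda>N. f N + g N)"
proof -
  obtain M M' where "\<forall>l\<in>#M. shape l" "\<forall>N. f N = (\<Sum>l\<in>#M. schur_poly x N l)"
    "\<forall>l\<in>#M'. shape l" "\<forall>N. g N = (\<Sum>l\<in>#M'. schur_poly x N l)"
    using assms by (auto simp: schur_nonneg_def)
  then show ?thesis
    unfolding schur_nonneg_def by (intro exI[of _ "M + M'"]) auto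
qed

lemma schur_nonneg_sum:
  assumes "finite A" "\<And>a. a \<in> A \<Longrightarrow> schur_nonneg x (f a)"
  shows "schur_nonneg x (\<lambda>N. \<Sum>a\<in>A. f a N)"
  using assms by (induction A rule: finite_induct) (auto intro: schur_nonneg_0 schur_nonneg_add)

lemma schur_nonneg_of_nat: "schur_nonneg x f \<Longrightarrow> schur_nonneg x (\<lambda>N. of_nat k * f N)"
  by (induction k) (auto simp: distrib_right intro: schur_nonneg_0 schur_nonneg_add)

lemma schur_nonneg_numeral:
  "schur_nonneg x f \<Longrightarrow> schur_nonneg x (\<lambda>N. numeral k * f N)"
  using schur_nonneg_of_nat[of x f "numeral k"] by simp

text \<open>The dual Pieri rule expands every summand, and the vertical strips occurring there do
  not depend on \<open>N\<close>.\<close>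

lemma schur_nonneg_elementary_mult:
  assumes "schur_nonneg x f"
  shows "schur_nonneg x (\<lambda>N. elementary x N k * f N)"
proof -
  obtain M where M: "\<forall>l\<in>#M. shape l" "\<And>N. f N = (\<Sum>l\<in>#M. schur_poly x N l)"
    using assms by (auto simp: schur_nonneg_def)
  have "schur_nonneg x (\<lambda>N. elementary x N k * (\<Sum>l\<in>#M. schur_poly x N l))"
    using M(1)
  proof (induction M)
    case empty
    then show ?case by (simp add: schur_nonneg_0)
  next
    case (add l M)
    then have "shape l" by simp
    have "schur_nonneg x (\<lambda>N. elementary x N k * schur_poly x N l)"
      unfolding dual_pieri[OF \<open>shape l\<close>]
      by (rule schur_nonneg_schur_sum[OF finite_vertical_strips[OF \<open>shape l\<close>] shape_vertical_strips])
    then show ?case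
      using add by (simp add: distrib_left schur_nonneg_add)
  qed
  then show ?thesis by (simp only: M(2))
qed

section \<open>Columns and hooks\<close>

definition column :: "nat \<Rightarrow> nat \<Rightarrow> nat" where
  "column k i = (if i < k then 1 else 0)"

lemma shape_column: "shape (column k)"
  by (rule shapeI[of _ k]) (auto simp: column_def)

lemma vertical_strips_empty: "vertical_strips k (\<lambda>_. 0) = {column k}"
proof -
  have "\<mu> = column k" if \<mu>: "\<mu> \<in> vertical_strips k (\<lambda>_. 0)" for \<mu>
  proof -
    obtain S where S: "shape \<mu>" "finite S" "card S = k" "\<mu> = add_cells (\<lambda>_. 0) S"
      using \<mu> by (auto simp: vertical_strips_def)
    have "i \<in> S" if "j \<in> S" "i \<le> j" for i j
      using shape_le[OF S(1) that(2)] that(1) by (auto simp: S(4) add_cells_def split: if_splits)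
    then have "S = {..<k}"
      using initial_segment_nat[OF S(2)] S(3) by blast
    then show ?thesis by (auto simp: S(4) add_cells_def column_def)
  qed
  moreover have "column k \<in> vertical_strips k (\<lambda>_. 0)"
    unfolding vertical_strips_def
    by (intro CollectI conjI exI[of _ "{..<k}"] shape_column) (auto simp: column_def add_cells_def)
  ultimately show ?thesis by blast
qed

lemma elementary_eq_schur_poly: "elementary x N k = schur_poly x N (column k)"
proof -
  have "shape (\<lambda>_. 0)" by (rule shapeI) auto
  from dual_pieri[OF this, of x N k] show ?thesis
    by (simp add: vertical_strips_empty schur_poly_empty)
qed

lemma schur_nonneg_elementary: "schur_nonneg x (\<lambda>N. elementary x N k)"
  using schur_nonneg_schur_sum[of "{column k}" x] by (simp add: elementary_eq_schur_poly shape_column)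

text \<open>By the dual Pieri rule the product is the sum over all ways to add one cell to
  \<open>column k\<close>; subtracting \<open>elementary x N (Suc k)\<close> deletes the summand in
  which the column grows.\<close>

lemma schur_nonneg_hook:
  "schur_nonneg x (\<lambda>N. elementary x N 1 * elementary x N k - elementary x N (Suc k))"
proof -
  let ?V = "vertical_strips 1 (column k)"
  have fin: "finite ?V" using finite_vertical_strips[OF shape_column] .
  have "column (Suc k) \<in> ?V"
    unfolding vertical_strips_def
    by (intro CollectI conjI exI[of _ "{k}"] shape_column) (auto simp: column_def add_cells_def)
  then have "elementary x N 1 * elementary x N k - elementary x N (Suc k) =
      (\<Sum>\<mu>\<in>?V - {column (Suc k)}. schur_poly x N \<mu>)" for N
    using dual_pieri[OF shape_column, of x N 1 k] fin
    by (simp add: elementary_eq_schur_poly[of x N k] elementary_eq_schur_poly[of x N "Suc k"] sum_diff1)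
  moreover have "schur_nonneg x (\<lambda>N. \<Sum>\<mu>\<in>?V - {column (Suc k)}. schur_poly x N \<mu>)"
    by (rule schur_nonneg_schur_sum) (use fin in \<open>auto dest: shape_vertical_strips\<close>)
  ultimately show ?thesis by (simp only:)
qed

subsection \<open>The induction\<close>

lemma schur_nonneg_path: "schur_nonneg x (\<lambda>N. path_poly x N n)"
proof (induction n rule: less_induct)
  case (less n)
  then show ?case
    unfolding path_poly_recurrence[of x _ n] mult.assoc
    by (intro schur_nonneg_add schur_nonneg_elementary schur_nonneg_sum schur_nonneg_of_nat
        schur_nonneg_elementary_mult) auto
qed

text \<open>
  For \<open>n \<ge> 7\<close> this is the chromatic symmetric function of \<open>S(n - 6, 4, 1)\<close>. The smaller \<open>n\<close> are
  included, with \<open>P m = 0\<close> for \<open>m < 0\<close>, so that the recurrence below can be run down to \<open>0\<close>.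
\<close>

definition spider_poly :: "(nat \<Rightarrow> 'a::comm_ring_1) \<Rightarrow> nat \<Rightarrow> nat \<Rightarrow> 'a" where
  "spider_poly x N n = path_poly x N n +
    elementary x N 1 * (if 1 \<le> n then path_poly x N (n - 1) else 0) -
    path_poly x N 5 * (if 5 \<le> n then path_poly x N (n - 5) else 0)"

text \<open>Extended by 0 below its start, a shifted solution satisfies the same recurrence, since
  the summands with \<open>n - Suc k < s\<close> vanish. The conditionals keep truncated subtraction
  from producing \<open>f 0\<close> instead.\<close>

lemma recurrence_shift:
  fixes f g c :: "nat \<Rightarrow> 'a::comm_ring_1"
  assumes "\<And>n. f n = g n + (\<Sum>k<n. c k * f (n - Suc k))"
  shows "(if s \<le> n then f (n - s) else 0) = (if s \<le> n then g (n - s) else 0) +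
    (\<Sum>k<n. c k * (if s \<le> n - Suc k then f (n - Suc k - s) else 0))"
proof (cases "s \<le> n")
  case True
  have "(\<Sum>k<n. c k * (if s \<le> n - Suc k then f (n - Suc k - s) else 0)) =
      (\<Sum>k<n - s. c k * f (n - s - Suc k))"
    using True by (intro sum.mono_neutral_cong_right) (auto simp: add.commute)
  then show ?thesis using True assms[of "n - s"] by simp
next
  case False
  then have "(\<Sum>k<n. c k * (if s \<le> n - Suc k then f (n - Suc k - s) else 0)) = 0"
    by (intro sum.neutral) auto
  then show ?thesis using False by simp
qed

text \<open>The linear combination of the path recurrence shifted by 0, 1 and 5, with coefficients
  1, \<open>elementary x N 1\<close> and \<open>- path_poly x N 5\<close>. For
  \<open>5 \<le> n\<close> all three inhomogeneous terms are present.\<close>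

lemma spider_poly_recurrence:
  assumes "5 \<le> n"
  shows "spider_poly x N n = elementary x N n + elementary x N 1 * elementary x N (n - 1) -
    path_poly x N 5 * elementary x N (n - 5) +
    (\<Sum>k<n. of_nat k * elementary x N (Suc k) * spider_poly x N (n - Suc k))"
proof -
  note shift = recurrence_shift[OF path_poly_recurrence[of x N]]
  have "spider_poly x N n = path_poly x N n +
      elementary x N 1 * path_poly x N (n - 1) - path_poly x N 5 * path_poly x N (n - 5)"
    using assms by (simp add: spider_poly_def)
  moreover note path_poly_recurrence[of x N n] shift[of 1 n] shift[of 5 n]
  ultimately show ?thesis
    unfolding spider_poly_def
    using assms
    by (simp add: distrib_left right_diff_distrib sum.distrib sum_subtractf sum_distrib_left mult_ac
        del: One_nat_def)
qed

text \<open>The recurrence unrolled, for the explicit identities in degrees 5 and 7 and the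
  cancellation in degree 6.\<close>

lemma path_poly_small:
  fixes x :: "nat \<Rightarrow> 'a::comm_ring_1" and N :: nat
  defines "e \<equiv> elementary x N"
  shows "path_poly x N 1 = e 1"
    and "path_poly x N 2 = 2 * e 2"
    and "path_poly x N 3 = 3 * e 3 + e 2 * e 1"
    and "path_poly x N 4 = 4 * e 4 + 2 * e 3 * e 1 + 2 * e 2 * e 2"
    and "path_poly x N 5 = 5 * e 5 + 3 * e 4 * e 1 + 7 * e 3 * e 2 + e 2 * e 2 * e 1"
    and "path_poly x N 6 = 6 * e 6 + 4 * e 5 * e 1 + 10 * e 4 * e 2 + 6 * e 3 * e 3 +
      4 * e 3 * e 2 * e 1 + 2 * e 2 * e 2 * e 2"
    and "path_poly x N 7 = 7 * e 7 + 5 * e 6 * e 1 + 13 * e 5 * e 2 + 6 * e 4 * e 2 * e 1 +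
      17 * e 4 * e 3 + 4 * e 3 * e 3 * e 1 + 11 * e 3 * e 2 * e 2 + e 2 * e 2 * e 2 * e 1"
proof -
  have rec: "path_poly x N (Suc n) = e (Suc n) +
      (\<Sum>k<Suc n. of_nat k * e (Suc k) * path_poly x N (n - k))" for n
    using path_poly_recurrence[of x N "Suc n"] by (simp add: e_def)
  note num = numeral_eq_Suc
  show p1: "path_poly x N 1 = e 1"
    using rec[of 0] by simp
  show p2: "path_poly x N 2 = 2 * e 2"
    using rec[of 1] p1 by (simp add: num algebra_simps)
  show p3: "path_poly x N 3 = 3 * e 3 + e 2 * e 1"
    using rec[of 2] p1 p2 by (simp add: num algebra_simps)
  show p4: "path_poly x N 4 = 4 * e 4 + 2 * e 3 * e 1 + 2 * e 2 * e 2"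
    using rec[of 3] p1 p2 p3 by (simp add: num algebra_simps)
  show p5: "path_poly x N 5 = 5 * e 5 + 3 * e 4 * e 1 + 7 * e 3 * e 2 + e 2 * e 2 * e 1"
    using rec[of 4] p1 p2 p3 p4 by (simp add: num algebra_simps)
  show p6: "path_poly x N 6 = 6 * e 6 + 4 * e 5 * e 1 + 10 * e 4 * e 2 + 6 * e 3 * e 3 +
      4 * e 3 * e 2 * e 1 + 2 * e 2 * e 2 * e 2"
    using rec[of 5] p1 p2 p3 p4 p5 by (simp add: num algebra_simps)
  show "path_poly x N 7 = 7 * e 7 + 5 * e 6 * e 1 + 13 * e 5 * e 2 + 6 * e 4 * e 2 * e 1 +
      17 * e 4 * e 3 + 4 * e 3 * e 3 * e 1 + 11 * e 3 * e 2 * e 2 + e 2 * e 2 * e 2 * e 1"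
    using rec[of 6] p1 p2 p3 p4 p5 p6 by (simp add: num algebra_simps)
qed

lemma schur_nonneg_hooks:
  shows "schur_nonneg x (\<lambda>N. elementary x N 1 * elementary x N 1 - elementary x N 2)"
    and "schur_nonneg x (\<lambda>N. elementary x N 1 * elementary x N 2 - elementary x N 3)"
    and "schur_nonneg x (\<lambda>N. elementary x N 1 * elementary x N 4 - elementary x N 5)"
  using schur_nonneg_hook[of x 1] schur_nonneg_hook[of x 2] schur_nonneg_hook[of x 4]
  by (simp_all add: numeral_eq_Suc)

lemmas schur_nonneg_intros = schur_nonneg_add schur_nonneg_of_nat schur_nonneg_numeral
  schur_nonneg_elementary_mult schur_nonneg_hooks schur_nonneg_elementary schur_nonneg_path

text \<open>In degree 7 the recurrence supplies \<open>e 2 * spider_poly x N 5\<close> only once,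
  whereas the absorption takes two copies. The only negative monomial in the expansion is
  \<open>- 3 * e 3 * e 2 * e 2\<close>, and the last summand pairs it with a hook.\<close>

lemma schur_nonneg_spider_poly_7: "schur_nonneg x (\<lambda>N. spider_poly x N 7)"
proof -
  have "spider_poly x N 7 =
      7 * e 7 + 3 * (e 5 * e 2) + e 2 * (e 2 * (e 2 * e 1)) + 10 * (e 4 * (e 2 * e 1)) +
      17 * (e 4 * e 3) + 10 * (e 3 * (e 3 * e 1)) + 11 * (e 6 * e 1) + e 3 * (e 2 * (e 1 * e 1)) +
      4 * (e 5 * (e 1 * e 1)) + 3 * (e 3 * (e 2 * (e 1 * e 1 - e 2)))"
    if "e = elementary x N" for e N
    unfolding that
    by (simp add: spider_poly_def path_poly_small[unfolded One_nat_def] algebra_simps)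
  from this[OF refl] show ?thesis
    by (simp only:) (intro schur_nonneg_intros)
qed

text \<open>In degree 5 the two copies of \<open>path_poly x N 5\<close> cancel, so the difference
  is \<open>2 * e 1 * path_poly x N 4 - path_poly x N 5\<close>. Its negative part is
  \<open>- 5 * e 5 - 7 * e 3 * e 2\<close>; the 7 is split as 3 + 4 between two kinds of
  hooks.\<close>

lemma schur_nonneg_degree_5:
  "schur_nonneg x (\<lambda>N. 2 * spider_poly x N 5 - path_poly x N 5)"
proof -
  have "2 * spider_poly x N 5 - path_poly x N 5 =
      5 * (e 1 * e 4 - e 5) + 3 * (e 2 * (e 1 * e 2 - e 3)) + 4 * (e 3 * (e 1 * e 1 - e 2))"
    if "e = elementary x N" for e N
    unfolding that
    by (simp add: spider_poly_def path_poly_small[unfolded One_nat_def] algebra_simps)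
  from this[OF refl] show ?thesis
    by (simp only:) (intro schur_nonneg_intros)
qed

lemma schur_nonneg_spider_poly: "schur_nonneg x (\<lambda>N. spider_poly x N n)"
proof (induction n rule: less_induct)
  case (less n)
  consider "n = 0" | "1 \<le> n" "n < 5" | "n = 5" | "n = 6" | "n = 7" | "8 \<le> n"
    by linarith
  then show ?case
  proof cases
    case 1
    then show ?thesis
      using schur_nonneg_path[of x 0] by (simp add: spider_poly_def)
  next
    case 2
    then have "spider_poly x N n = path_poly x N n + elementary x N 1 * path_poly x N (n - 1)" for N
      by (simp add: spider_poly_def)
    then show ?thesis by (simp only:) (intro schur_nonneg_intros)
  next
    case 3
    then have "spider_poly x N n = elementary x N 1 * path_poly x N 4" for N
      by (simp add: spider_poly_def)
    then show ?thesis by (simp only:) (intro schur_nonneg_intros)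
  next
    \<comment> \<open>Here \<open>path_poly x N 1 = elementary x N 1\<close>, so the last two terms
      of \<open>spider_poly\<close> cancel.\<close>
    case 4
    then have "spider_poly x N n = path_poly x N 6" for N
      using path_poly_small(1)[of x N] by (simp add: spider_poly_def)
    then show ?thesis by (simp only:) (intro schur_nonneg_intros)
  next
    case 5
    then show ?thesis by (simp only: schur_nonneg_spider_poly_7)
  next
    case 6
    let ?e = "elementary x"
    let ?t = "\<lambda>k N. of_nat k * (?e N (Suc k) * spider_poly x N (n - Suc k))"
    \<comment> \<open>The summand \<open>k = n - 6\<close> carries
      \<open>?e N (n - 5) * spider_poly x N 5\<close> with coefficient
      \<open>n - 6 = (n - 8) + 2\<close>. Two of these copies absorb the negative term;
      \<open>8 \<le> n\<close> keeps the remaining coefficient nonnegative.\<close>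
    have "spider_poly x N n = ?e N n + ?e N 1 * ?e N (n - 1) +
        ?e N (n - 5) * (of_nat (n - 8) * spider_poly x N 5 +
          (2 * spider_poly x N 5 - path_poly x N 5)) +
        (\<Sum>k\<in>{..<n} - {n - 6}. ?t k N)" for N
    proof -
      have "(\<Sum>k<n. ?t k N) = ?t (n - 6) N + (\<Sum>k\<in>{..<n} - {n - 6}. ?t k N)"
        using 6 by (intro sum.remove) auto
      moreover have "?t (n - 6) N = ?e N (n - 5) * (of_nat (n - 8) * spider_poly x N 5 +
          2 * spider_poly x N 5)"
      proof -
        have "Suc (n - 6) = n - 5" "n - (n - 5) = 5" "n - 6 = (n - 8) + 2" using 6 by auto
        then show ?thesis
          by (simp only: of_nat_add of_nat_numeral) (simp add: algebra_simps)
      qed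
      ultimately show ?thesis
        using spider_poly_recurrence[of n x N] 6 by (simp add: mult.assoc right_diff_distrib distrib_left)
    qed
    moreover have "schur_nonneg x (\<lambda>N. \<Sum>k\<in>{..<n} - {n - 6}. ?t k N)"
      using less by (intro schur_nonneg_sum schur_nonneg_of_nat schur_nonneg_elementary_mult) auto
    moreover have "schur_nonneg x (\<lambda>N. spider_poly x N 5)"
      using less 6 by simp
    ultimately show ?thesis
      using schur_nonneg_degree_5[of x]
      by (simp only:) (rule schur_nonneg_intros | assumption)+
  qed
qed

subsection \<open>From polynomials to power series\<close>

text \<open>Polynomials form the monoid algebra over multisets under addition, matching the encoding
  of monomials in \<open>power_series\<close>; \<open>lookup\<close> extracts a coefficient.\<close>

definition variable :: "nat \<Rightarrow> nat multiset \<Rightarrow>\<^sub>0 int" where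
  "variable i = Poly_Mapping.single {#i#} 1"

lemma prod_variable:
  "finite A \<Longrightarrow> (\<Prod>p\<in>A. variable (f p)) = Poly_Mapping.single (image_mset f (mset_set A)) 1"
  by (induction A rule: finite_induct) (simp_all add: variable_def mult_single flip: single_one)

lemma lookup_sum_prod_variable:
  assumes "finite V" "finite C"
  shows "Poly_Mapping.lookup (\<Sum>c\<in>C. \<Prod>v\<in>V. variable (c v)) m =
    int (card {c \<in> C. image_mset c (mset_set V) = m})"
  using assms by (simp add: prod_variable lookup_sum lookup_single when_def sum.If_cases Int_def eq_commute[of m])

definition row_lengths :: "nat list \<Rightarrow> nat \<Rightarrow> nat" where
  "row_lengths L i = (if i < length L then L ! i else 0)"

lemma diagram_row_lengths: "diagram (row_lengths L) = cells L"
  by (auto simp: diagram_def cells_def row_lengths_def split: if_splits)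

text \<open>A tableau with content \<open>m\<close> uses only entries occurring in \<open>m\<close>,
  so bounding the entries by \<open>N\<close> does not change this coefficient.\<close>

lemma schur_function_eq_lookup:
  assumes "shape (row_lengths L)" "set_mset m \<subseteq> {..N}"
  shows "schur_function L m = Poly_Mapping.lookup (schur_poly variable N (row_lengths L)) m"
proof -
  have "{T \<in> ssyt L. image_mset T (mset_set (cells L)) = m} =
      {T \<in> tableaux N (row_lengths L). image_mset T (mset_set (cells L)) = m}"
    (is "?A = ?B")
  proof (intro equalityI subsetI)
    fix T assume T: "T \<in> ?A"
    have "T p \<le> N" if "p \<in> cells L" for p
      using T that assms(2) by (auto simp: image_subset_iff)
    then show "T \<in> ?B"
      using T by (auto simp: ssyt_def tableaux_def diagram_row_lengths PiE_iff Suc_le_eq)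
  next
    fix T assume "T \<in> ?B"
    then show "T \<in> ?A"
      by (auto simp: ssyt_def tableaux_def diagram_row_lengths PiE_iff Suc_le_eq)
  qed
  then show ?thesis
    using finite_tableaux[OF assms(1)]
    by (simp add: schur_function_def schur_poly_def lookup_sum_prod_variable diagram_row_lengths)
qed

lemma finite_bounded_colorings: "finite (fst G) \<Longrightarrow> finite (bounded_colorings N G)"
proof (rule finite_subset)
  show "bounded_colorings N G \<subseteq> fst G \<rightarrow>\<^sub>E {1..N}"
    by (auto simp: bounded_colorings_def proper_colorings_def PiE_def Pi_def image_subset_iff)
qed (simp add: finite_PiE)

lemma chromatic_symmetric_function_eq_lookup:
  assumes "finite (fst G)" "set_mset m \<subseteq> {..N}"
  shows "chromatic_symmetric_function G m =
    Poly_Mapping.lookup (\<Sum>c\<in>bounded_colorings N G. \<Prod>v\<in>fst G. variable (c v)) m"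
proof -
  have "{c \<in> proper_colorings G. image_mset c (mset_set (fst G)) = m} =
      {c \<in> bounded_colorings N G. image_mset c (mset_set (fst G)) = m}"
    (is "?A = ?B")
  proof (intro equalityI subsetI)
    fix c assume c: "c \<in> ?A"
    have "c v \<le> N" if "v \<in> fst G" for v
      using c that assms by (auto simp: image_subset_iff)
    then show "c \<in> ?B"
      using c by (auto simp: bounded_colorings_def proper_colorings_def PiE_iff Suc_le_eq)
  qed (auto simp: bounded_colorings_def)
  then show ?thesis
    using assms(1) finite_bounded_colorings[OF assms(1), of N]
    by (simp add: chromatic_symmetric_function_def lookup_sum_prod_variable)
qed

lemma shape_row_lengths:
  assumes "shape l"
  shows "\<exists>L. is_partition L \<and> row_lengths L = l"
proof -
  define n where "n = (LEAST i. l i = 0)"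
  obtain i where "l i = 0" using assms by (auto simp: shape_def)
  then have ln: "l n = 0"
    unfolding n_def by (rule LeastI[of "\<lambda>i. l i = 0"])
  have pos: "l i \<noteq> 0" if "i < n" for i
    using that not_less_Least[of i "\<lambda>i. l i = 0"] unfolding n_def by simp
  have zero: "l i = 0" if "n \<le> i" for i
    using shape_le[OF assms that] ln by simp
  have "is_partition (map l [0..<n])"
    using pos by (fastforce simp: is_partition_def sorted_wrt_iff_nth_less intro: shape_le[OF assms])
  moreover have "row_lengths (map l [0..<n]) = l"
    using zero by (auto simp: row_lengths_def)
  ultimately show ?thesis by blast
qed

lemma sum_mset_eq_sum_count:
  fixes f :: "'b \<Rightarrow> int"
  shows "(\<Sum>l\<in>#M. f l) = (\<Sum>l\<in>set_mset M. int (count M l) * f l)"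
proof (induction M)
  case (add a M)
  have "(\<Sum>l\<in>set_mset (add_mset a M). int (count (add_mset a M) l) * f l) =
      (\<Sum>l\<in>insert a (set_mset M). int (count M l) * f l + (if l = a then f l else 0))"
    by (intro sum.cong) (auto simp: algebra_simps)
  also have "\<dots> = (\<Sum>l\<in>insert a (set_mset M). int (count M l) * f l) + f a"
    by (simp add: sum.distrib)
  also have "(\<Sum>l\<in>insert a (set_mset M). int (count M l) * f l) =
      (\<Sum>l\<in>set_mset M. int (count M l) * f l)"
    by (intro sum.mono_neutral_right) (auto simp: not_in_iff)
  finally show ?case using add by simp
qed simp

text \<open>The multiplicities in one multiset \<open>M\<close> serve as Schur coefficients. Each
  coefficient of \<open>f\<close> is checked in a number of variables large enough for its monomial,
  and the same \<open>M\<close> works for all of them.\<close>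

lemma schur_positive_if_schur_nonneg:
  assumes f: "\<And>N m. set_mset m \<subseteq> {..N} \<Longrightarrow> f m = Poly_Mapping.lookup (p N) m"
    and p: "schur_nonneg variable p"
  shows "schur_positive f"
proof -
  obtain M where M: "\<forall>l\<in>#M. shape l" "\<And>N. p N = (\<Sum>l\<in>#M. schur_poly variable N l)"
    using p by (auto simp: schur_nonneg_def)
  obtain g where g: "\<And>l. shape l \<Longrightarrow> is_partition (g l) \<and> row_lengths (g l) = l"
    using shape_row_lengths by metis
  define R where "R = image_mset g M"
  have supp: "{L. int (count R L) \<noteq> 0} = set_mset R" by auto
  have "f m = (\<Sum>L | int (count R L) \<noteq> 0. int (count R L) * schur_function L m)" for m
  proof -
    obtain N where N: "set_mset m \<subseteq> {..N}"
      using finite_nat_set_iff_bounded_le[of "set_mset m"] by auto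
    have "Poly_Mapping.lookup (\<Sum>l\<in>#M. schur_poly variable N l) m = (\<Sum>l\<in>#M. schur_function (g l) m)"
      using M(1)
    proof (induction M)
      case (add l M)
      then have "shape l" by simp
      then have "schur_function (g l) m = Poly_Mapping.lookup (schur_poly variable N l) m"
        using schur_function_eq_lookup[of "g l" m N] g[of l] N by simp
      then show ?case using add by (simp add: lookup_add)
    qed simp
    then have "f m = (\<Sum>L\<in>#R. schur_function L m)"
      using f[OF N] M(2) by (simp add: R_def multiset.map_comp comp_def)
    then show ?thesis unfolding supp sum_mset_eq_sum_count .
  qed
  moreover have "is_partition L" if "int (count R L) \<noteq> 0" for L
  proof -
    have "L \<in># R" using that by (simp add: count_eq_zero_iff)
    then show ?thesis using g M(1) by (auto simp: R_def)
  qed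
  ultimately have "schur_expansion f (\<lambda>L. int (count R L))"
    unfolding schur_expansion_def supp by auto
  then show ?thesis unfolding schur_positive_def by auto
qed

theorem theorem4p6:
  fixes a :: nat
  assumes "a \<ge> 4"
  shows "schur_positive (chromatic_symmetric_function (spider [a, 4, 1]))"
proof (rule schur_positive_if_schur_nonneg)
  fix N and m :: "nat multiset" assume "set_mset m \<subseteq> {..N}"
  moreover have "finite (fst (spider [a, 4, 1]))"
    using simple_graph_spider by (auto simp: simple_graph_def)
  ultimately have "chromatic_symmetric_function (spider [a, 4, 1]) m =
      Poly_Mapping.lookup (\<Sum>c\<in>bounded_colorings N (spider [a, 4, 1]). \<Prod>v\<in>fst (spider [a, 4, 1]). variable (c v)) m"
    by (intro chromatic_symmetric_function_eq_lookup)
  \<comment> \<open>With \<open>b = 4\<close> the path indices in \<open>sum_spider_words\<close>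
    are \<open>a + 6\<close>, \<open>a + 5\<close>, 5 and \<open>a + 1\<close>, which are those of
    \<open>spider_poly\<close> at \<open>n = a + 6\<close>.\<close>
  also have "(\<Sum>c\<in>bounded_colorings N (spider [a, 4, 1]). \<Prod>v\<in>fst (spider [a, 4, 1]). variable (c v)) =
      spider_poly variable N (a + 6)"
    unfolding sum_bounded_colorings_spider sum_spider_words
    by (simp add: spider_poly_def numeral_eq_Suc)
  finally show "chromatic_symmetric_function (spider [a, 4, 1]) m =
      Poly_Mapping.lookup (spider_poly variable N (a + 6)) m" .
qed (rule schur_nonneg_spider_poly)

end
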